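(* Let $\vec w\in\mathcal{O}_D$ be a distinct vector, with associated angle $a=a_{\vec w}$, fundamental domain $F=F_{\vec w}$ and cone $F_{a/4}$. Let $K\subset\mathcal{U}_d$ be such that there exists a compact convex set $K'\subset F_{a/4}$ with $q:K'\to K$ a homeomorphism, and let $\phi=q^{-1}:K\to K'$. Let $Q'$ be a probability distribution supported on $K'$, let $Q=q_*Q'$ be its pushforward, supported on $K=q(K')$ (which has a unique Fréchet mean), and let $\mu$ be the Fréchet mean of $Q$. Let $\mu_n$ be the empirical Fréchet mean of an i.i.d. sample $X_1,\dots,X_n\sim Q$ with respect to the Procrustean distance $d_P$. Then, as $n\to\infty$, $$\sqrt{n}\,\bigl(\phi(\mu_n)-\phi(\mu)\bigr)\xrightarrow{\;L\;}N(0,\Sigma),$$ where $\Sigma=\Lambda^{-1}C\Lambda^{-1}$, with Hessian matrix $$\Lambda=\Bigl(\mathbb{E}\bigl[D_{r,s}\|\phi(\mu)-\phi(X_1)\|^2\bigr]\Bigr)_{r,s=1,\dots,D},$$ and $C$ is the covariance matrix of $\{D_r\|\phi(\mu)-\phi(X_1)\|^2\}_{r=1,\dots,D}$.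
   Context: Let $D=\binom d2$ and $\mathcal{O}_D=\{\vec x\in\mathbb{R}^D: x^i\ge0\}$, whose coordinates are indexed by the edges $\{i,j\}$, $1\le i<j\le d$ (vectors of edge weights of labeled undirected networks on $d$ vertices). The group $\Sigma_d$ of permutations of $\{1,\dots,d\}$ acts on $\mathcal{O}_D$ by $(\sigma\cdot\vec x)_{\{i,j\}}=\vec x_{\{\sigma^{-1}(i),\sigma^{-1}(j)\}}$. The space of unlabeled networks is $\mathcal{U}_d=\mathcal{O}_D/\Sigma_d$, with projection $q:\mathcal{O}_D\to\mathcal{U}_d$, $q(\vec x)=[\vec x]$. With $d_E$ Euclidean distance, the Procrustean distance is $d_P([\vec x],[\vec y])=\min_{\sigma_1,\sigma_2\in\Sigma_d}d_E(\sigma_1\cdot\vec x,\sigma_2\cdot\vec y)$. A vector $\vec w\in\mathcal{O}_D$ is distinct if $\sigma\cdot\vec w\ne\vec w$ for all $\sigma\in\Sigma_d$, $\sigma\neq\mathrm{id}$. For distinct $\vec w$: $F_{\vec w}=\{\vec w'\in\mathcal{O}_D: d_E(\vec w,\vec w')\le d_E(\vec w,\sigma\cdot\vec w')\ \forall\sigma\in\Sigma_d\}$; $a=a_{\vec w}$ is the smallest angle between $\vec w$ and $\sigma\cdot\vec w$ over $\sigma\in\Sigma_d$, $\sigma\ne\mathrm{id}$; and $F_c$ denotes the solid cone in $\mathcal{O}_D$ with vertex at the origin, axis $\vec w$ and cone angle $c$, i.e. the set of $\vec u\in\mathcal{O}_D$ that are $\vec 0$ or make an angle at most $c$ with $\vec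 w$. For a probability distribution $Q$ on $\mathcal{U}_d$, a Fréchet mean of $Q$ is a minimizer over $p\in\mathcal{U}_d$ of $\int_{\mathcal{U}_d}d_P^2(p,z)\,Q(dz)$; an empirical Fréchet mean of $X_1,\dots,X_n$ is a minimizer of $p\mapsto\frac1n\sum_i d_P^2(p,X_i)$. $D_r$ denotes the partial derivative in the $r$-th coordinate direction and $D_{r,s}$ second partial derivatives, here of the function $\vec x\mapsto\|\vec x-\phi(X_1)\|^2$ on $\mathbb{R}^D$, evaluated at $\vec x=\phi(\mu)$. $\xrightarrow{L}$ is convergence in law. *)

theory Defs
  imports "HOL-Probability.Probability"
begin

section \<open>Labeled networks and the action of the symmetric group\<close>

text \<open>
  The vertex set is an arbitrary finite type \<open>'v\<close> with at least two elements; its cardinality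
  plays the role of \<open>d\<close>.  Edges are the two-element sets of vertices, so that
  \<open>CARD('v edge) = d choose 2\<close>, and \<open>real ^ 'v edge\<close> is the space of edge weight vectors.
  (For \<open>d = 1\<close> there are no coordinates and no nontrivial permutations, and the angle
  of a distinct vector is a minimum over the empty set.)
\<close>

typedef ('v::card2) edge = "{e :: 'v set. card e = 2}"
proof -
  obtain S :: "'v set" where "card S = 2"
    using obtain_subset_with_card_n[OF two_le_card[where 'a='v]] by metis
  then show ?thesis by blast
qed

instance edge :: (card2) finite
proof
  have "finite (range (Rep_edge :: 'a edge \<Rightarrow> 'a set))" by simp
  then show "finite (UNIV :: 'a edge set)"
    by (rule finite_imageD) (simp add: inj_on_def Rep_edge_inject)
qed

lemma card_edge: "CARD('v::card2 edge) = CARD('v) choose 2"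
proof -
  have "CARD('v edge) = card {e :: 'v set. card e = 2}"
    by (rule type_definition.card[OF type_definition_edge])
  also have "\<dots> = CARD('v) choose 2"
    using n_subsets[of "UNIV :: 'v set" 2] by simp
  finally show ?thesis .
qed

type_synonym 'v weights = "real ^ ('v edge)"

definition orthant :: "('v::card2) weights set" where
  "orthant = {x. \<forall>e. 0 \<le> x $ e}"

definition perms :: "('v \<Rightarrow> 'v) set" where
  "perms = {\<sigma>. \<sigma> permutes UNIV}"

definition edge_image :: "('v \<Rightarrow> 'v) \<Rightarrow> ('v::card2) edge \<Rightarrow> 'v edge" where
  "edge_image \<sigma> e = Abs_edge (\<sigma> ` Rep_edge e)"

definition act :: "('v \<Rightarrow> 'v) \<Rightarrow> ('v::card2) weights \<Rightarrow> 'v weights" where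
  "act \<sigma> x = (\<chi> e. x $ edge_image (inv \<sigma>) e)"

lemma finite_perms [simp]: "finite (perms :: ('v::finite \<Rightarrow> 'v) set)"
  unfolding perms_def by (rule finite_permutations) simp

lemma id_in_perms [simp]: "id \<in> perms"
  by (simp add: perms_def permutes_id)

lemma inv_in_perms: "\<sigma> \<in> perms \<Longrightarrow> inv \<sigma> \<in> perms"
  by (simp add: perms_def permutes_inv)

lemma comp_in_perms: "\<sigma> \<in> perms \<Longrightarrow> \<tau> \<in> perms \<Longrightarrow> \<sigma> \<circ> \<tau> \<in> perms"
  by (simp add: perms_def permutes_compose)

lemma perms_bij: "\<sigma> \<in> perms \<Longrightarrow> bij \<sigma>"
  by (simp add: perms_def permutes_bij)

lemma Rep_edge_image:
  assumes "\<sigma> \<in> perms"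
  shows "Rep_edge (edge_image \<sigma> e) = \<sigma> ` Rep_edge e"
proof -
  have "inj_on \<sigma> (Rep_edge e)"
    using perms_bij[OF assms] by (meson bij_is_inj inj_on_subset subset_UNIV)
  then have "card (\<sigma> ` Rep_edge e) = 2"
    using Rep_edge[of e] by (simp add: card_image)
  then show ?thesis by (simp add: edge_image_def Abs_edge_inverse)
qed

lemma edge_image_comp:
  assumes "\<sigma> \<in> perms" "\<tau> \<in> perms"
  shows "edge_image \<sigma> (edge_image \<tau> e) = edge_image (\<sigma> \<circ> \<tau>) e"
  using assms by (simp add: Rep_edge_inject[symmetric] Rep_edge_image comp_in_perms image_comp)

lemma edge_image_id [simp]: "edge_image id e = e"
  by (simp add: edge_image_def Rep_edge_inverse)

lemma act_id [simp]: "act id x = x"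
  by (simp add: act_def vec_eq_iff)

lemma act_act:
  assumes "\<sigma> \<in> perms" "\<tau> \<in> perms"
  shows "act \<sigma> (act \<tau> x) = act (\<sigma> \<circ> \<tau>) x"
  using assms
  by (simp add: act_def vec_eq_iff edge_image_comp inv_in_perms o_inv_distrib perms_bij)

lemma act_inv [simp]:
  assumes "\<sigma> \<in> perms"
  shows "act (inv \<sigma>) (act \<sigma> x) = x" "act \<sigma> (act (inv \<sigma>) x) = x"
proof -
  have "inv \<sigma> \<circ> \<sigma> = id" "\<sigma> \<circ> inv \<sigma> = id"
    using assms unfolding perms_def by (auto dest: permutes_inv_o)
  then show "act (inv \<sigma>) (act \<sigma> x) = x" "act \<sigma> (act (inv \<sigma>) x) = x"
    using assms by (simp_all add: act_act inv_in_perms)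
qed

lemma act_diff: "act \<sigma> (x - y) = act \<sigma> x - act \<sigma> y"
  by (simp add: act_def vec_eq_iff)

lemma act_in_orthant: "x \<in> orthant \<Longrightarrow> act \<sigma> x \<in> orthant"
  by (simp add: act_def orthant_def)

lemma norm_act:
  assumes "\<sigma> \<in> perms"
  shows "norm (act \<sigma> x) = norm x"
proof -
  have i: "inv \<sigma> \<in> perms" by (rule inv_in_perms[OF assms])
  have c: "inv \<sigma> \<circ> \<sigma> = id" "\<sigma> \<circ> inv \<sigma> = id"
    using assms unfolding perms_def by (auto dest: permutes_inv_o)
  have "bij (edge_image (inv \<sigma>) :: 'a edge \<Rightarrow> 'a edge)"
    by (rule bij_betw_byWitness[where f'="edge_image \<sigma>"])
       (simp_all add: edge_image_comp assms i c)
  then have "(\<Sum>e\<in>UNIV. (norm (x $ edge_image (inv \<sigma>) e))\<^sup>2) = (\<Sum>e\<in>UNIV. (norm (x $ e))\<^sup>2)"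
    by (rule sum.reindex_bij_betw[where g="\<lambda>e. (norm (x $ e))\<^sup>2"])
  then show ?thesis by (simp add: norm_vec_def L2_set_def act_def)
qed

lemma dist_act: "\<sigma> \<in> perms \<Longrightarrow> dist (act \<sigma> x) (act \<sigma> y) = dist x y"
  by (simp add: dist_norm norm_act flip: act_diff)


section \<open>Unlabeled networks and the Procrustean distance\<close>

definition same_network :: "('v::card2) weights \<Rightarrow> 'v weights \<Rightarrow> bool" where
  "same_network x y \<longleftrightarrow> x \<in> orthant \<and> y \<in> orthant \<and> (\<exists>\<sigma>\<in>perms. y = act \<sigma> x)"

lemma part_equivp_same_network: "part_equivp (same_network :: ('v::card2) weights \<Rightarrow> _)"
proof (rule part_equivpI)
  have "same_network (0 :: 'v weights) 0"
    unfolding same_network_def orthant_def by (auto intro!: bexI[of _ id])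
  then show "\<exists>x. same_network (x :: 'v weights) x" by blast
  show "symp (same_network :: 'v weights \<Rightarrow> _)"
    unfolding same_network_def by (rule sympI) (metis act_inv(1) inv_in_perms)
  show "transp (same_network :: 'v weights \<Rightarrow> _)"
    unfolding same_network_def by (rule transpI) (metis act_act comp_in_perms)
qed

text \<open>The quotient of \<^const>\<open>orthant\<close> by \<^const>\<open>perms\<close>.  The relation is partial, so the
  elements of the type are precisely the orbits inside the orthant.\<close>

quotient_type 'v unlabeled_network = "('v::card2) weights" / partial: same_network
  by (rule part_equivp_same_network)

text \<open>The projection.  Outside the orthant, where the equivalence class is empty, it takes a
  single unspecified value.\<close>

definition q :: "('v::card2) weights \<Rightarrow> 'v unlabeled_network" where
  "q = abs_unlabeled_network"

lemma q_eq_iff: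
  assumes "x \<in> orthant" "y \<in> orthant"
  shows "q x = q y \<longleftrightarrow> (\<exists>\<sigma>\<in>perms. y = act \<sigma> x)"
proof -
  have refl: "same_network z z" if "z \<in> orthant" for z :: "'a weights"
    using that unfolding same_network_def by (auto intro!: bexI[of _ id])
  show ?thesis
    using Quotient3_rel[OF Quotient3_unlabeled_network, of x y] refl assms
    unfolding q_def by (auto simp: same_network_def)
qed

lemma q_cases:
  obtains x where "x \<in> orthant" "p = q x"
proof -
  have "same_network (rep_unlabeled_network p) (rep_unlabeled_network p)"
    by (rule Quotient3_rep_reflp[OF Quotient3_unlabeled_network])
  moreover have "p = q (rep_unlabeled_network p)"
    unfolding q_def by (rule Quotient3_abs_rep[OF Quotient3_unlabeled_network, symmetric])
  ultimately show thesis using that by (auto simp: same_network_def)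
qed

lemma q_outside: "x \<notin> orthant \<Longrightarrow> y \<notin> orthant \<Longrightarrow> q x = q y"
proof -
  assume "x \<notin> orthant" "y \<notin> orthant"
  then have "same_network x = same_network y"
    by (auto simp: same_network_def fun_eq_iff)
  moreover have "quot_type (same_network :: 'a weights \<Rightarrow> _)
      Abs_unlabeled_network Rep_unlabeled_network"
    by (rule quot_type.intro[OF part_equivp_same_network])
       (use unlabeled_network.Rep_unlabeled_network in
         \<open>auto simp: unlabeled_network.Rep_unlabeled_network_inverse
           unlabeled_network.Abs_unlabeled_network_inverse
           unlabeled_network.Rep_unlabeled_network_inject\<close>)
  ultimately show ?thesis
    unfolding q_def abs_unlabeled_network_def by (simp add: quot_type.abs_def)
qed

definition procrustes :: "('v::card2) weights \<Rightarrow> 'v weights \<Rightarrow> real" where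
  "procrustes x y = Min {dist (act \<sigma>\<^sub>1 x) (act \<sigma>\<^sub>2 y) | \<sigma>\<^sub>1 \<sigma>\<^sub>2. \<sigma>\<^sub>1 \<in> perms \<and> \<sigma>\<^sub>2 \<in> perms}"

lemma finite_procrustes:
  "finite {dist (act \<sigma>\<^sub>1 x) (act \<sigma>\<^sub>2 y) | \<sigma>\<^sub>1 \<sigma>\<^sub>2. \<sigma>\<^sub>1 \<in> perms \<and> \<sigma>\<^sub>2 \<in> perms}"
  by (rule finite_image_set2) simp_all

lemma procrustes_le:
  "\<sigma>\<^sub>1 \<in> perms \<Longrightarrow> \<sigma>\<^sub>2 \<in> perms \<Longrightarrow> procrustes x y \<le> dist (act \<sigma>\<^sub>1 x) (act \<sigma>\<^sub>2 y)"
  unfolding procrustes_def by (rule Min_le[OF finite_procrustes]) blast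

lemma procrustes_attained:
  obtains \<sigma>\<^sub>1 \<sigma>\<^sub>2 where "\<sigma>\<^sub>1 \<in> perms" "\<sigma>\<^sub>2 \<in> perms" "procrustes x y = dist (act \<sigma>\<^sub>1 x) (act \<sigma>\<^sub>2 y)"
proof -
  let ?S = "{dist (act \<sigma>\<^sub>1 x) (act \<sigma>\<^sub>2 y) | \<sigma>\<^sub>1 \<sigma>\<^sub>2. \<sigma>\<^sub>1 \<in> perms \<and> \<sigma>\<^sub>2 \<in> perms}"
  have "?S \<noteq> {}" using id_in_perms by blast
  then have "procrustes x y \<in> ?S"
    unfolding procrustes_def by (rule Min_in[OF finite_procrustes])
  then show thesis using that by blast
qed

lemma procrustes_act_le:
  assumes "\<sigma> \<in> perms" "\<tau> \<in> perms"
  shows "procrustes (act \<sigma> x) (act \<tau> y) \<le> procrustes x y"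
proof -
  obtain s t where st: "s \<in> perms" "t \<in> perms" "procrustes x y = dist (act s x) (act t y)"
    by (rule procrustes_attained)
  have "procrustes (act \<sigma> x) (act \<tau> y)
      \<le> dist (act (s \<circ> inv \<sigma>) (act \<sigma> x)) (act (t \<circ> inv \<tau>) (act \<tau> y))"
    using st assms by (intro procrustes_le comp_in_perms inv_in_perms)
  also have "\<dots> = procrustes x y"
    using st assms by (simp add: inv_in_perms flip: act_act)
  finally show ?thesis .
qed

lemma procrustes_act:
  assumes "\<sigma> \<in> perms" "\<tau> \<in> perms"
  shows "procrustes (act \<sigma> x) (act \<tau> y) = procrustes x y"
  using procrustes_act_le[OF assms, of x y]
    procrustes_act_le[OF assms[THEN inv_in_perms], of "act \<sigma> x" "act \<tau> y"] assms
  by simp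

lemma procrustes_triangle: "procrustes x z \<le> procrustes x y + procrustes z y"
proof -
  obtain s t where st: "s \<in> perms" "t \<in> perms" "procrustes x y = dist (act s x) (act t y)"
    by (rule procrustes_attained)
  obtain u v where uv: "u \<in> perms" "v \<in> perms" "procrustes z y = dist (act u z) (act v y)"
    by (rule procrustes_attained)
  define r where "r = v \<circ> inv t"
  have r: "r \<in> perms" unfolding r_def using st uv by (intro comp_in_perms inv_in_perms)
  have "act r (act t y) = act v y"
    unfolding r_def using st uv by (simp add: inv_in_perms flip: act_act)
  then have "procrustes x y = dist (act (r \<circ> s) x) (act v y)"
    using st r dist_act[of r "act s x" "act t y"] by (simp add: act_act)
  moreover have "procrustes x z \<le> dist (act (r \<circ> s) x) (act u z)"
    using st uv r by (intro procrustes_le comp_in_perms)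
  ultimately show ?thesis
    using uv(3) dist_triangle2[of "act (r \<circ> s) x" "act u z" "act v y"] by linarith
qed

instantiation unlabeled_network :: (card2) metric_space
begin

lift_definition dist_unlabeled_network ::
  "'a unlabeled_network \<Rightarrow> 'a unlabeled_network \<Rightarrow> real" is procrustes
  by (auto simp: same_network_def procrustes_act)

definition uniformity_unlabeled_network ::
  "('a unlabeled_network \<times> 'a unlabeled_network) filter" where
  "uniformity_unlabeled_network = (INF e\<in>{0<..}. principal {(p, p'). dist p p' < e})"

definition open_unlabeled_network :: "'a unlabeled_network set \<Rightarrow> bool" where
  "open_unlabeled_network U \<longleftrightarrow>
     (\<forall>p\<in>U. eventually (\<lambda>(p', p''). p' = p \<longrightarrow> p'' \<in> U) uniformity)"

lemma dist_q_aux: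
  assumes "x \<in> orthant" "y \<in> orthant"
  shows "dist (q x) (q y) = procrustes x y"
proof -
  have "same_network x x" "same_network y y"
    using assms unfolding same_network_def by (auto intro!: bexI[of _ id])
  then show ?thesis
    unfolding q_def by (rule dist_unlabeled_network.abs_eq)
qed

instance
proof
  fix p p' p'' :: "'a unlabeled_network"
  obtain x where x: "x \<in> orthant" "p = q x" by (rule q_cases)
  obtain y where y: "y \<in> orthant" "p' = q y" by (rule q_cases)
  obtain z where z: "z \<in> orthant" "p'' = q z" by (rule q_cases)
  show "dist p p' = 0 \<longleftrightarrow> p = p'"
  proof
    assume "dist p p' = 0"
    then have 0: "procrustes x y = 0" using x y by (simp add: dist_q_aux)
    obtain s t where st: "s \<in> perms" "t \<in> perms" "procrustes x y = dist (act s x) (act t y)"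
      by (rule procrustes_attained)
    then have "act s x = act t y" using 0 by simp
    then have "y = act (inv t) (act s x)" using st by simp
    then have "y = act (inv t \<circ> s) x" using st by (simp add: act_act inv_in_perms)
    moreover have "inv t \<circ> s \<in> perms" using st by (intro comp_in_perms inv_in_perms)
    ultimately have "q x = q y"
      unfolding q_eq_iff[OF x(1) y(1)] by (rule bexI)
    then show "p = p'" using x y by simp
  next
    assume "p = p'"
    have "procrustes x x \<le> 0" using procrustes_le[of id id x x] by simp
    moreover have "0 \<le> procrustes x x"
      by (rule procrustes_attained[of x x]) simp
    ultimately have "dist (q x) (q x) = 0"
      using dist_q_aux[OF x(1) x(1)] by linarith
    then show "dist p p' = 0" using \<open>p = p'\<close> x(2) by simp
  qed
  show "dist p p' \<le> dist p p'' + dist p' p''"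
    using procrustes_triangle[of x y z] unfolding x(2) y(2) z(2)
    by (simp only: dist_q_aux[OF x(1) y(1)] dist_q_aux[OF x(1) z(1)] dist_q_aux[OF y(1) z(1)])
qed (simp_all add: uniformity_unlabeled_network_def open_unlabeled_network_def)

end

lemma dist_q:
  assumes "x \<in> orthant" "y \<in> orthant"
  shows "dist (q x) (q y) =
    Min {dist (act \<sigma>\<^sub>1 x) (act \<sigma>\<^sub>2 y) | \<sigma>\<^sub>1 \<sigma>\<^sub>2. \<sigma>\<^sub>1 \<in> perms \<and> \<sigma>\<^sub>2 \<in> perms}"
  using dist_q_aux[OF assms] by (simp add: procrustes_def)

lemma dist_q_le: "x \<in> orthant \<Longrightarrow> y \<in> orthant \<Longrightarrow> dist (q x) (q y) \<le> dist x y"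
  using procrustes_le[of id id x y] by (simp add: dist_q_aux)

lemma continuous_on_q: "continuous_on orthant q"
  unfolding continuous_on_iff using dist_q_le by (meson le_less_trans)

text \<open>The topology induced by the Procrustean distance is the quotient topology.\<close>

lemma open_iff_quotient:
  "open U \<longleftrightarrow> openin (top_of_set orthant) (orthant \<inter> q -` U)"
proof
  assume "open U"
  then show "openin (top_of_set orthant) (orthant \<inter> q -` U)"
    by (rule continuous_openin_preimage_gen[OF continuous_on_q])
next
  assume *: "openin (top_of_set orthant) (orthant \<inter> q -` U)"
  show "open U"
    unfolding open_dist
  proof
    fix p assume "p \<in> U"
    obtain x where x: "x \<in> orthant" "p = q x" by (rule q_cases)
    then have "x \<in> orthant \<inter> q -` U" using \<open>p \<in> U\<close> by simp
    then obtain e where e: "e > 0" "\<And>y. y \<in> orthant \<Longrightarrow> dist y x < e \<Longrightarrow> q y \<in> U"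
      using * unfolding openin_euclidean_subtopology_iff by blast
    have "p' \<in> U" if "dist p' p < e" for p'
    proof -
      obtain y where y: "y \<in> orthant" "p' = q y" by (rule q_cases)
      obtain s t where st: "s \<in> perms" "t \<in> perms" "procrustes y x = dist (act s y) (act t x)"
        by (rule procrustes_attained)
      define r where "r = inv t \<circ> s"
      have r: "r \<in> perms" unfolding r_def using st by (intro comp_in_perms inv_in_perms)
      have "dist (act r y) x = dist (act (inv t) (act s y)) (act (inv t) (act t x))"
        unfolding r_def using st by (simp add: act_act[symmetric] inv_in_perms)
      also have "\<dots> = dist (act s y) (act t x)"
        using st by (intro dist_act inv_in_perms)
      finally have "dist (act r y) x < e"
        using that st x y by (simp add: dist_q_aux)
      then have "q (act r y) \<in> U" using y by (intro e act_in_orthant)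
      moreover have "q y = q (act r y)"
        using q_eq_iff[OF y(1) act_in_orthant[OF y(1)]] r by blast
      ultimately show ?thesis using y by simp
    qed
    then show "\<exists>e>0. \<forall>p'. dist p' p < e \<longrightarrow> p' \<in> U" using e by blast
  qed
qed

lemma closed_orthant: "closed (orthant :: ('v::card2) weights set)"
  unfolding orthant_def
  by (intro closed_Collect_all closed_Collect_le continuous_intros)

text \<open>In particular pushing a Borel measure on \<open>\<real>\<^sup>D\<close> forward along \<^const>\<open>q\<close> is meaningful.\<close>

lemma measurable_q [measurable]: "q \<in> borel_measurable borel"
proof -
  define c where "c = q (SOME x. (x :: 'a weights) \<notin> orthant)"
  have "q = (\<lambda>x. if x \<in> orthant then q x else c)"
    unfolding c_def fun_eq_iff using q_outside by (metis someI)
  moreover have "(\<lambda>x. if x \<in> orthant then q x else c) \<in> borel_measurable borel"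
    by (rule borel_measurable_continuous_on_if)
       (auto intro: continuous_on_q closed_orthant borel_closed)
  ultimately show ?thesis by simp
qed


section \<open>Distinct vectors, angles and cones\<close>

definition distinct_weights :: "('v::card2) weights \<Rightarrow> bool" where
  "distinct_weights w \<longleftrightarrow> w \<in> orthant \<and> (\<forall>\<sigma>\<in>perms. \<sigma> \<noteq> id \<longrightarrow> act \<sigma> w \<noteq> w)"

definition angle :: "'a::real_inner \<Rightarrow> 'a \<Rightarrow> real" where
  "angle x y = arccos (x \<bullet> y / (norm x * norm y))"

definition min_angle :: "('v::card2) weights \<Rightarrow> real" where
  "min_angle w = Min {angle w (act \<sigma> w) | \<sigma>. \<sigma> \<in> perms \<and> \<sigma> \<noteq> id}"

definition fundamental_domain :: "('v::card2) weights \<Rightarrow> 'v weights set" where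
  "fundamental_domain w = {w' \<in> orthant. \<forall>\<sigma>\<in>perms. dist w w' \<le> dist w (act \<sigma> w')}"

definition cone_about :: "('v::card2) weights \<Rightarrow> real \<Rightarrow> 'v weights set" where
  "cone_about w c = {u \<in> orthant. u = 0 \<or> angle u w \<le> c}"


section \<open>Frechet means\<close>

text \<open>Using the nonnegative integral, no integrability side condition is hidden in the
  definition.\<close>

definition frechet_mean :: "'a::metric_space measure \<Rightarrow> 'a \<Rightarrow> bool" where
  "frechet_mean Q p \<longleftrightarrow>
     (\<forall>p'. (\<integral>\<^sup>+z. ennreal ((dist p z)\<^sup>2) \<partial>Q) \<le> (\<integral>\<^sup>+z. ennreal ((dist p' z)\<^sup>2) \<partial>Q))"

text \<open>The sample points are \<open>x 0, \<dots>, x (n - 1)\<close>.\<close>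

definition empirical_frechet_mean :: "nat \<Rightarrow> (nat \<Rightarrow> 'a::metric_space) \<Rightarrow> 'a \<Rightarrow> bool" where
  "empirical_frechet_mean n x p \<longleftrightarrow>
     (\<forall>p'. (1 / real n) * (\<Sum>i<n. (dist p (x i))\<^sup>2) \<le> (1 / real n) * (\<Sum>i<n. (dist p' (x i))\<^sup>2))"


section \<open>Partial derivatives, normal distributions and convergence in law\<close>

definition partial_deriv :: "'n \<Rightarrow> (real ^ 'n \<Rightarrow> real) \<Rightarrow> real ^ 'n \<Rightarrow> real" where
  "partial_deriv r f x = deriv (\<lambda>t. f (x + t *\<^sub>R axis r 1)) 0"

text \<open>The normal distribution on \<open>\<real>\<^sup>n\<close>, given by its characteristic function; the covariance
  matrix may be singular.\<close>

definition normal_law :: "(real ^ 'n) measure \<Rightarrow> real ^ 'n \<Rightarrow> real ^ 'n ^ 'n \<Rightarrow> bool" where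
  "normal_law N m S \<longleftrightarrow>
     prob_space N \<and> sets N = sets borel \<and> transpose S = S \<and>
     (\<forall>t. (CLINT x|N. iexp (t \<bullet> x)) = exp (\<i> * of_real (t \<bullet> m) - of_real (t \<bullet> (S *v t)) / 2))"

definition converges_in_law ::
  "'w measure \<Rightarrow> (nat \<Rightarrow> 'w \<Rightarrow> 'b::topological_space) \<Rightarrow> 'b measure \<Rightarrow> bool" where
  "converges_in_law M Z N \<longleftrightarrow>
     (\<forall>n. Z n \<in> borel_measurable M) \<and>
     (\<forall>f :: 'b \<Rightarrow> real. continuous_on UNIV f \<and> bounded (range f) \<longrightarrow>
        (\<lambda>n. \<integral>\<omega>. f (Z n \<omega>) \<partial>M) \<longlonglongrightarrow> (\<integral>x. f x \<partial>N))"

definition covariance_matrix :: "'w measure \<Rightarrow> ('w \<Rightarrow> real ^ 'n) \<Rightarrow> real ^ 'n ^ 'n" where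
  "covariance_matrix M Y =
     (\<chi> r s. \<integral>\<omega>. (Y \<omega> $ r - (\<integral>\<omega>'. Y \<omega>' $ r \<partial>M)) * (Y \<omega> $ s - (\<integral>\<omega>'. Y \<omega>' $ s \<partial>M)) \<partial>M)"

end

theory Submission
  imports Defs
begin

text \<open>
  Within the cone of angle \<open>a/4\<close> the identity permutation aligns any two vectors optimally, strictly
  so unless one of them vanishes.  For a random point \<open>Y\<close> of \<open>K'\<close> and any \<open>z\<close>, aligning \<open>Y\<close> with \<open>z\<close>
  gives a random vector \<open>T\<close> with \<open>|E T| \<le> |E Y|\<close>; as
  \<open>E d\<^sub>P(z, Y)\<^sup>2 = |z - E T|\<^sup>2 + E |Y|\<^sup>2 - |E T|\<^sup>2\<close>, the Frechet mean is the class of \<open>E Y\<close>.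
  Applied to \<open>Q'\<close> and to the empirical measure, this identifies \<open>\<phi> \<mu>\<close> with the expectation and
  \<open>\<phi> \<mu>\<^sub>n\<close> with the sample average, so that the claim is the multivariate central limit theorem.
  The latter follows from the one-dimensional theorem by pointwise convergence of
  characteristic functions and tightness.
\<close>

section \<open>Convergence in law from characteristic functions\<close>

text \<open>The competitors in a Frechet mean range over all unlabeled networks, and a
  representative z outside the cone may require a different permutation for each sample point. Hence
  the alignment T depends on the point and has to be chosen measurably, and E T is compared with E Y
  only through T \<bullet> T', whose bound concerns pairs of points of K' irrespective of z.

  The angle a/4 is the threshold of that bound: two points x, y of the cone are at most a/2 apart,
  while a nontrivial \<sigma> leaves \<sigma>x at an angle of at least a - 2(a/4) = a/2 from y.
  Since the cone is closed, ties at the threshold need an extra argument, and the zero vector, fixed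
  by every permutation, is a separate case in the uniqueness proof.

  The squared distance has Hessian 2I and gradient 2(x - Y), so the sandwich formula collapses to
  the covariance of Y, which is the covariance in the central limit theorem. It may be singular, so
  the limit is built from independent standard normals instead of from a density.\<close>

inductive trig_poly :: "('a::euclidean_space \<Rightarrow> real) \<Rightarrow> bool" where
  cos: "trig_poly (\<lambda>x. c * cos (t \<bullet> x + b))"
| add: "trig_poly f \<Longrightarrow> trig_poly g \<Longrightarrow> trig_poly (\<lambda>x. f x + g x)"

lemma trig_poly_const: "trig_poly (\<lambda>_. c)"
  using trig_poly.cos[of c 0 0] by simp

lemma trig_poly_sum:
  "finite A \<Longrightarrow> (\<And>i. i \<in> A \<Longrightarrow> trig_poly (f i)) \<Longrightarrow> trig_poly (\<lambda>x. \<Sum>i\<in>A. f i x)"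
  by (induction A rule: finite_induct) (auto intro: trig_poly_const trig_poly.add)

text \<open>The product-to-sum formula. The free phase in each term lets cosines alone form an
  algebra, sines being cosines shifted by pi/2.\<close>

lemma trig_poly_cos_mult:
  assumes "trig_poly f"
  shows "trig_poly (\<lambda>x. c * cos (t \<bullet> x + b) * f x)"
  using assms
proof induction
  case (cos c' t' b')
  have "c * cos (t \<bullet> x + b) * (c' * cos (t' \<bullet> x + b'))
      = c * c' / 2 * cos ((t + t') \<bullet> x + (b + b')) + c * c' / 2 * cos ((t - t') \<bullet> x + (b - b'))" for x
  proof -
    have 1: "(t + t') \<bullet> x + (b + b') = (t \<bullet> x + b) + (t' \<bullet> x + b')"
      "(t - t') \<bullet> x + (b - b') = (t \<bullet> x + b) - (t' \<bullet> x + b')"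
      by (simp_all add: inner_simps)
    show ?thesis
      unfolding 1 cos_add cos_diff by (simp add: field_simps)
  qed
  then show ?case by (simp only:) (intro trig_poly.intros)
next
  case (add f g)
  then show ?case by (simp only: distrib_left) (intro trig_poly.intros)
qed

lemma trig_poly_mult:
  assumes "trig_poly f" "trig_poly g"
  shows "trig_poly (\<lambda>x. f x * g x)"
  using assms(1)
proof induction
  case (cos c t b)
  then show ?case by (rule trig_poly_cos_mult[OF assms(2)])
next
  case (add f g)
  then show ?case by (simp only: distrib_right) (intro trig_poly.intros)
qed

lemma trig_poly_sin: "trig_poly (\<lambda>x. c * sin (x \<bullet> i / L))"
proof -
  have "c * sin (x \<bullet> i / L) = c * cos ((i /\<^sub>R L) \<bullet> x + (- pi / 2))" for x
  proof -
    have "(i /\<^sub>R L) \<bullet> x = x \<bullet> i / L"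
      by (simp add: divide_inverse inner_commute)
    then have "(i /\<^sub>R L) \<bullet> x + (- pi / 2) = x \<bullet> i / L - pi / 2" by simp
    then have "cos ((i /\<^sub>R L) \<bullet> x + (- pi / 2)) = sin (x \<bullet> i / L)"
      by (simp only: cos_diff) simp
    then show ?thesis by (simp only:)
  qed
  then show ?thesis by (simp only:) (rule trig_poly.cos)
qed

text \<open>Lets Weierstrass approximation in the variables sin(x_i / L) produce trigonometric
  polynomials in x.\<close>

lemma trig_poly_real_polynomial_sin:
  fixes p :: "'a::euclidean_space \<Rightarrow> real"
  assumes "real_polynomial_function p"
  shows "trig_poly (\<lambda>x. p (\<Sum>i\<in>Basis. sin (x \<bullet> i / L) *\<^sub>R i))"
  using assms
proof induction
  case (linear f)
  then interpret bounded_linear f .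
  have "f (\<Sum>i\<in>Basis. sin (x \<bullet> i / L) *\<^sub>R i) = (\<Sum>i\<in>Basis. f i * sin (x \<bullet> i / L))" for x :: 'a
    by (simp add: sum scale mult.commute)
  then show ?case by (simp only:) (intro trig_poly_sum trig_poly_sin finite_Basis)
qed (auto intro: trig_poly_const trig_poly.add trig_poly_mult)

text \<open>On the ball, \<open>f\<close> agrees with \<open>x \<mapsto> f (L arcsin (sin (x / L)))\<close> (taken
  coordinatewise), which is a continuous function of \<open>sin (x / L)\<close>.\<close>

lemma trig_poly_approx:
  fixes f :: "'a::euclidean_space \<Rightarrow> real"
  assumes f: "continuous_on UNIV f" and B: "\<And>x. \<bar>f x\<bar> \<le> B" and e: "e > 0"
  obtains g where "trig_poly g" "\<And>x. norm x \<le> R \<Longrightarrow> \<bar>f x - g x\<bar> \<le> e" "\<And>x. \<bar>g x\<bar> \<le> B + e"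
proof -
  \<comment> \<open>\<open>L \<ge> R\<close> gives |x_i / L| \<le> 1 \<le> pi/2 on the ball, where
    arcsin inverts sin; the maximum with 1 keeps L positive for every R.\<close>
  define L where "L = max 1 R"
  have L: "L > 0" "R \<le> L" by (auto simp: L_def)
  define S :: "'a set" where "S = cbox (- One) One"
  have S: "\<bar>s \<bullet> i\<bar> \<le> 1" if "s \<in> S" "i \<in> Basis" for s i
    using that by (auto simp: S_def mem_box abs_le_iff minus_le_iff)
  define h where "h s = f (\<Sum>i\<in>Basis. (L * arcsin (s \<bullet> i)) *\<^sub>R i)" for s :: 'a
  define sn where "sn x = (\<Sum>i\<in>Basis. sin (x \<bullet> i / L) *\<^sub>R i)" for x :: 'a
  have "continuous_on S h"
    unfolding h_def
    by (rule continuous_on_compose2[OF f])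
       (auto intro!: continuous_intros dest: S simp: abs_le_iff minus_le_iff)
  then obtain p where p: "real_polynomial_function p" "\<And>s. s \<in> S \<Longrightarrow> \<bar>h s - p s\<bar> < e"
    using Stone_Weierstrass_real_polynomial_function[of S h e] e by (auto simp: S_def)
  have sn: "sn x \<in> S" for x
    by (auto simp: S_def sn_def mem_box minus_le_iff)
  \<comment> \<open>\<open>sn x\<close> stays in the cube for every x, not only for x in the ball.
    The approximation error is therefore global, which yields the bound B + e outside the ball even
    though p is a polynomial.\<close>
  have close: "\<bar>h (sn x) - p (sn x)\<bar> < e" for x
    by (rule p(2)[OF sn])
  have hB: "\<bar>h s\<bar> \<le> B" for s by (simp add: h_def B)
  have hf: "h (sn x) = f x" if "norm x \<le> R" for x
  proof -
    have "L * arcsin (sin (x \<bullet> i / L)) = x \<bullet> i" if "i \<in> Basis" for i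
    proof -
      have "\<bar>x \<bullet> i\<bar> \<le> L" using Basis_le_norm[OF that, of x] \<open>norm x \<le> R\<close> L by linarith
      then have "\<bar>x \<bullet> i / L\<bar> \<le> 1" using L by (simp add: abs_divide)
      then have "\<bar>x \<bullet> i / L\<bar> \<le> pi / 2" using pi_ge_two by linarith
      then have "arcsin (sin (x \<bullet> i / L)) = x \<bullet> i / L"
        by (intro arcsin_sin) linarith+
      then show ?thesis using L by simp
    qed
    then show ?thesis
      by (simp add: h_def sn_def inner_sum_left_Basis euclidean_representation cong: sum.cong)
  qed
  show thesis
  proof
    show "trig_poly (\<lambda>x. p (sn x))"
      unfolding sn_def by (rule trig_poly_real_polynomial_sin[OF p(1)])
    show "\<bar>f x - p (sn x)\<bar> \<le> e" if "norm x \<le> R" for x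
      using close[of x] hf[OF that] by simp
    show "\<bar>p (sn x)\<bar> \<le> B + e" for x
      using close[of x] hB[of "sn x"] by linarith
  qed
qed

section \<open>Expectations of trigonometric polynomials\<close>

lemma trig_poly_continuous: "trig_poly f \<Longrightarrow> continuous_on UNIV f"
  by (induction rule: trig_poly.induct) (auto intro!: continuous_intros)

lemma trig_poly_bounded: "trig_poly f \<Longrightarrow> \<exists>B. \<forall>x. \<bar>f x\<bar> \<le> B"
proof (induction rule: trig_poly.induct)
  case (cos c t b)
  show ?case by (rule exI[of _ "\<bar>c\<bar>"]) (auto simp: abs_mult intro!: mult_left_le)
next
  case (add f g)
  then obtain B B' where "\<And>x. \<bar>f x\<bar> \<le> B" "\<And>x. \<bar>g x\<bar> \<le> B'" by auto
  then have "\<bar>f x + g x\<bar> \<le> B + B'" for x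
    by (intro order_trans[OF abs_triangle_ineq] add_mono)
  then show ?case by blast
qed

lemma (in prob_space) integrable_continuous_bounded:
  fixes f :: "'b::euclidean_space \<Rightarrow> real"
  assumes "continuous_on UNIV f" "\<And>x. \<bar>f x\<bar> \<le> B" "Z \<in> borel_measurable M"
  shows "integrable M (\<lambda>\<omega>. f (Z \<omega>))"
  using assms
  by (intro integrable_const_bound[of _ B] measurable_compose[OF assms(3)] borel_measurable_continuous_onI)
     auto

text \<open>The link to characteristic functions: the shifted cosine is the real part of
  \<open>iexp b * iexp (t \<bullet> Z \<omega>)\<close>.\<close>

lemma (in prob_space) expectation_cos:
  fixes Z :: "'a \<Rightarrow> 'b::euclidean_space"
  assumes [measurable]: "Z \<in> borel_measurable M"
  shows "(\<integral>\<omega>. c * cos (t \<bullet> Z \<omega> + b) \<partial>M) = c * Re (iexp b * (CLINT \<omega>|M. iexp (t \<bullet> Z \<omega>)))"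
proof -
  have int: "complex_integrable M (\<lambda>\<omega>. iexp (t \<bullet> Z \<omega>))"
    by (rule integrable_const_bound[of _ 1]) auto
  have "Re (iexp b * (CLINT \<omega>|M. iexp (t \<bullet> Z \<omega>))) = Re (CLINT \<omega>|M. iexp b * iexp (t \<bullet> Z \<omega>))"
    by simp
  also have "\<dots> = (\<integral>\<omega>. Re (iexp b * iexp (t \<bullet> Z \<omega>)) \<partial>M)"
    using int by (intro integral_Re[symmetric]) simp
  also have "(\<lambda>\<omega>. Re (iexp b * iexp (t \<bullet> Z \<omega>))) = (\<lambda>\<omega>. cos (t \<bullet> Z \<omega> + b))"
    by (simp add: exp_add[symmetric] algebra_simps Re_exp flip: of_real_add)
  finally show ?thesis by simp
qed

lemma trig_poly_tendsto:
  fixes Z :: "nat \<Rightarrow> 'w \<Rightarrow> 'b::euclidean_space"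
  assumes M: "prob_space M" and N: "prob_space N" "sets N = sets borel"
    and Z: "\<And>n. Z n \<in> borel_measurable M"
    and char: "\<And>t. (\<lambda>n. CLINT \<omega>|M. iexp (t \<bullet> Z n \<omega>)) \<longlonglongrightarrow> (CLINT x|N. iexp (t \<bullet> x))"
    and g: "trig_poly g"
  shows "(\<lambda>n. \<integral>\<omega>. g (Z n \<omega>) \<partial>M) \<longlonglongrightarrow> (\<integral>x. g x \<partial>N)"
  using g
proof induction
  interpret M: prob_space M by fact
  interpret N: prob_space N by fact
  have id: "(\<lambda>x. x) \<in> borel_measurable N" using N(2) by (simp add: measurable_def sets_eq_imp_space_eq)
  case (cos c t b)
  show ?case
    unfolding M.expectation_cos[OF Z] N.expectation_cos[OF id]
    by (intro tendsto_intros char)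
next
  interpret M: prob_space M by fact
  interpret N: prob_space N by fact
  have id: "(\<lambda>x. x) \<in> borel_measurable N" using N(2) by (simp add: measurable_def sets_eq_imp_space_eq)
  case (add f g)
  have "integrable M (\<lambda>\<omega>. f (Z n \<omega>))" "integrable N f" if "trig_poly f" for f n
    using trig_poly_bounded[OF that] M.integrable_continuous_bounded[OF trig_poly_continuous[OF that] _ Z]
      N.integrable_continuous_bounded[OF trig_poly_continuous[OF that] _ id] by auto
  then show ?case using add by (auto intro: tendsto_add)
qed

text \<open>On the ball the integrands differ by at most e; outside it they differ by at most B + (B
  + e), on an event of probability at most d.\<close>

lemma (in prob_space) expectation_approx:
  fixes f g :: "'b::euclidean_space \<Rightarrow> real"
  assumes f: "continuous_on UNIV f" "\<And>x. \<bar>f x\<bar> \<le> B"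
    and g: "continuous_on UNIV g" "\<And>x. \<bar>g x\<bar> \<le> B + e" "\<forall>x. norm x \<le> R \<longrightarrow> \<bar>f x - g x\<bar> \<le> e"
    and Z: "Z \<in> borel_measurable M" and tail: "prob {\<omega>\<in>space M. norm (Z \<omega>) > R} \<le> d"
    and e: "e \<ge> 0"
  shows "\<bar>(\<integral>\<omega>. f (Z \<omega>) \<partial>M) - (\<integral>\<omega>. g (Z \<omega>) \<partial>M)\<bar> \<le> e + (2 * B + e) * d"
proof -
  note [measurable] = Z
  let ?A = "{\<omega>\<in>space M. norm (Z \<omega>) > R}"
  have B: "0 \<le> B" using f(2)[of 0] by linarith
  have if': "integrable M (\<lambda>\<omega>. f (Z \<omega>))" and ig: "integrable M (\<lambda>\<omega>. g (Z \<omega>))"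
    using integrable_continuous_bounded[OF f Z] integrable_continuous_bounded[OF g(1,2) Z] .
  have "\<bar>(\<integral>\<omega>. f (Z \<omega>) \<partial>M) - (\<integral>\<omega>. g (Z \<omega>) \<partial>M)\<bar> \<le> (\<integral>\<omega>. \<bar>f (Z \<omega>) - g (Z \<omega>)\<bar> \<partial>M)"
    using if' ig integral_abs_bound[of M "\<lambda>\<omega>. f (Z \<omega>) - g (Z \<omega>)"] by simp
  also have "\<dots> \<le> (\<integral>\<omega>. e + (2 * B + e) * indicator ?A \<omega> \<partial>M)"
  proof (rule integral_mono)
    fix \<omega> assume "\<omega> \<in> space M"
    then show "\<bar>f (Z \<omega>) - g (Z \<omega>)\<bar> \<le> e + (2 * B + e) * indicator ?A \<omega>"
      using g(3)[rule_format, of "Z \<omega>"] f(2)[of "Z \<omega>"] g(2)[of "Z \<omega>"] e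
      by (auto simp: indicator_def not_less)
  qed (use if' ig in \<open>auto intro!: integrable_add integrable_mult_right simp: emeasure_eq_measure\<close>)
  also have "\<dots> = e + (2 * B + e) * prob ?A"
    by (subst Bochner_Integration.integral_add) (auto simp: prob_space emeasure_eq_measure)
  also have "\<dots> \<le> e + (2 * B + e) * d"
    using tail B e by (intro add_left_mono mult_left_mono) auto
  finally show ?thesis .
qed

lemma (in prob_space) tight_single:
  fixes Z :: "'a \<Rightarrow> 'b::euclidean_space"
  assumes [measurable]: "Z \<in> borel_measurable M" and e: "e > 0"
  shows "\<exists>R. prob {\<omega>\<in>space M. norm (Z \<omega>) > R} \<le> e"
proof -
  let ?A = "\<lambda>n::nat. {\<omega>\<in>space M. norm (Z \<omega>) > real n}"
  have "(\<lambda>n. prob (?A n)) \<longlonglongrightarrow> prob (\<Inter>n. ?A n)"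
    by (rule finite_Lim_measure_decseq) (auto simp: decseq_def)
  also have "(\<Inter>n. ?A n) = {}"
  proof (rule equals0I)
    fix \<omega> assume "\<omega> \<in> (\<Inter>n. ?A n)"
    then have "real n < norm (Z \<omega>)" for n by auto
    then show False using reals_Archimedean2[of "norm (Z \<omega>)"] less_asym by blast
  qed
  finally have "(\<lambda>n. prob (?A n)) \<longlonglongrightarrow> 0" by simp
  then have "\<forall>\<^sub>F n in sequentially. prob (?A n) < e"
    using e by (rule order_tendstoD)
  then obtain n where "prob (?A n) < e"
    using eventually_happens'[OF sequentially_bot] by blast
  then show ?thesis by (intro exI[of _ "real n"]) simp
qed

text \<open>Tightness reduces f to a ball, up to small probability; there a single bounded
  trigonometric polynomial replaces it, and its expectations converge by the hypothesis on
  characteristic functions.\<close>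

proposition tight_char_tendsto:
  fixes Z :: "nat \<Rightarrow> 'w \<Rightarrow> 'b::euclidean_space"
  assumes M: "prob_space M" and N: "prob_space N" "sets N = sets borel"
    and Z: "\<And>n. Z n \<in> borel_measurable M"
    and tight: "\<And>e. e > 0 \<Longrightarrow> \<exists>R. \<forall>n. measure M {\<omega>\<in>space M. norm (Z n \<omega>) > R} \<le> e"
    and char: "\<And>t. (\<lambda>n. CLINT \<omega>|M. iexp (t \<bullet> Z n \<omega>)) \<longlonglongrightarrow> (CLINT x|N. iexp (t \<bullet> x))"
    and f: "continuous_on UNIV f" "bounded (range f)"
  shows "(\<lambda>n. \<integral>\<omega>. f (Z n \<omega>) \<partial>M) \<longlonglongrightarrow> (\<integral>x. f x \<partial>N :: real)"
proof (rule LIMSEQ_I)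
  interpret M: prob_space M by fact
  interpret N: prob_space N by fact
  have id: "(\<lambda>x. x) \<in> borel_measurable N" using N(2) by (simp add: measurable_def sets_eq_imp_space_eq)
  fix r :: real assume r: "r > 0"
  obtain B where B: "\<And>x. \<bar>f x\<bar> \<le> B" using f(2) by (auto simp: bounded_iff)
  have B0: "0 \<le> B" using B[of 0] by linarith
  \<comment> \<open>Approximation and tail both receive the error e. The total e + (2B + e)e is at
    most (2B + 2)e because e \<le> 1, hence at most r/4; it is incurred once under M and once under
    N, and the convergence for g takes the remaining r/3.\<close>
  define e where "e = min 1 (r / (4 * (2 * B + 3)))"
  have e: "0 < e" "e \<le> 1" using r B0 by (auto simp: e_def)
  have er: "e + (2 * B + e) * e < r / 3"
  proof -
    have "(2 * B + e) * e \<le> (2 * B + 1) * e" using e by (intro mult_right_mono) auto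
    then have "e + (2 * B + e) * e \<le> (2 * B + 2) * e" by (simp add: algebra_simps)
    also have "\<dots> < (2 * B + 3) * e" using e by simp
    also have "\<dots> \<le> (2 * B + 3) * (r / (4 * (2 * B + 3)))"
      using B0 by (intro mult_left_mono) (auto simp: e_def)
    also have "\<dots> = r / 4" using B0 by (simp add: divide_simps)
    finally show ?thesis using r by linarith
  qed
  obtain R1 where R1: "\<And>n. measure M {\<omega>\<in>space M. norm (Z n \<omega>) > R1} \<le> e"
    using tight[OF e(1)] by blast
  obtain R2 where R2: "measure N {x\<in>space N. norm x > R2} \<le> e"
    using N.tight_single[OF id e(1)] by blast
  define R where "R = max R1 R2"
  have tM: "measure M {\<omega>\<in>space M. norm (Z n \<omega>) > R} \<le> e" for n
    using Z[of n] by (intro order_trans[OF M.finite_measure_mono R1[of n]]) (auto simp: R_def)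
  have tN: "measure N {x\<in>space N. norm x > R} \<le> e"
    using id by (intro order_trans[OF N.finite_measure_mono R2]) (auto simp: R_def)
  obtain g where g: "trig_poly g" "\<And>x. norm x \<le> R \<Longrightarrow> \<bar>f x - g x\<bar> \<le> e" "\<And>x. \<bar>g x\<bar> \<le> B + e"
    using trig_poly_approx[OF f(1) B e(1)] by metis
  have g': "\<forall>x. norm x \<le> R \<longrightarrow> \<bar>f x - g x\<bar> \<le> e" using g(2) by blast
  have gc: "continuous_on UNIV g" by (rule trig_poly_continuous[OF g(1)])
  have "\<forall>\<^sub>F n in sequentially. dist (\<integral>\<omega>. g (Z n \<omega>) \<partial>M) (\<integral>x. g x \<partial>N) < r / 3"
    using trig_poly_tendsto[OF M N Z char g(1)] r by (intro tendstoD) auto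
  then obtain n0 where n0: "\<And>n. n \<ge> n0 \<Longrightarrow> \<bar>(\<integral>\<omega>. g (Z n \<omega>) \<partial>M) - (\<integral>x. g x \<partial>N)\<bar> < r / 3"
    by (auto simp: eventually_sequentially dist_real_def)
  have "norm ((\<integral>\<omega>. f (Z n \<omega>) \<partial>M) - (\<integral>x. f x \<partial>N)) < r" if "n \<ge> n0" for n
    using M.expectation_approx[OF f(1) B gc g(3) g' Z tM, of n] N.expectation_approx[OF f(1) B gc g(3) g' id tN]
      n0[OF that] er e(1)
    unfolding real_norm_def by linarith
  then show "\<exists>n0. \<forall>n\<ge>n0. norm ((\<integral>\<omega>. f (Z n \<omega>) \<partial>M) - (\<integral>x. f x \<partial>N)) < r" by blast
qed


section \<open>The multivariate central limit theorem\<close>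

text \<open>Independence and zero means make the cross terms vanish. This bounds the second moments
  of the normalised sums, from which tightness follows.\<close>

lemma (in prob_space) expectation_sum_squared:
  fixes W :: "nat \<Rightarrow> 'a \<Rightarrow> real"
  assumes indep: "indep_vars (\<lambda>_. borel) W UNIV"
    and sq: "\<And>i. integrable M (\<lambda>\<omega>. (W i \<omega>)\<^sup>2)"
    and mean: "\<And>i. expectation (W i) = 0"
    and var: "\<And>i. expectation (\<lambda>\<omega>. (W i \<omega>)\<^sup>2) = v"
  shows "expectation (\<lambda>\<omega>. (\<Sum>i<n. W i \<omega>)\<^sup>2) = real n * v"
    and "integrable M (\<lambda>\<omega>. (\<Sum>i<n. W i \<omega>)\<^sup>2)"
proof -
  have W [measurable]: "W i \<in> borel_measurable M" for i
    using indep unfolding indep_vars_def2 by simp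
  have int: "integrable M (W i)" for i
    by (rule square_integrable_imp_integrable[OF W sq])
  have prod: "integrable M (\<lambda>\<omega>. W i \<omega> * W j \<omega>)"
    "expectation (\<lambda>\<omega>. W i \<omega> * W j \<omega>) = (if i = j then v else 0)" for i j
  proof -
    have "integrable M (\<lambda>\<omega>. W i \<omega> * W j \<omega>) \<and>
      expectation (\<lambda>\<omega>. W i \<omega> * W j \<omega>) = (if i = j then v else 0)"
    proof (cases "i = j")
      case True
      then show ?thesis using sq[of i] var[of i] by (simp add: power2_eq_square)
    next
      case False
      have *: "indep_vars (\<lambda>_. borel) W {i, j}" by (rule indep_vars_subset[OF indep]) simp
      have "integrable M (\<lambda>\<omega>. \<Prod>k\<in>{i, j}. W k \<omega>)"
        by (rule indep_vars_integrable[OF _ *]) (auto intro: int)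
      moreover have "expectation (\<lambda>\<omega>. \<Prod>k\<in>{i, j}. W k \<omega>) = (\<Prod>k\<in>{i, j}. expectation (W k))"
        by (rule indep_vars_lebesgue_integral[OF _ *]) (auto intro: int)
      ultimately show ?thesis using False mean by simp
    qed
    then show "integrable M (\<lambda>\<omega>. W i \<omega> * W j \<omega>)"
      "expectation (\<lambda>\<omega>. W i \<omega> * W j \<omega>) = (if i = j then v else 0)" by auto
  qed
  have eq: "(\<Sum>i<n. W i \<omega>)\<^sup>2 = (\<Sum>i<n. \<Sum>j<n. W i \<omega> * W j \<omega>)" for \<omega>
    by (simp add: power2_eq_square sum_product)
  show "integrable M (\<lambda>\<omega>. (\<Sum>i<n. W i \<omega>)\<^sup>2)"
    unfolding eq by (intro Bochner_Integration.integrable_sum prod(1))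
  have "expectation (\<lambda>\<omega>. (\<Sum>i<n. W i \<omega>)\<^sup>2) = (\<Sum>i<n. \<Sum>j<n. if i = j then v else 0)"
    unfolding eq by (simp add: prod Bochner_Integration.integral_sum)
  then show "expectation (\<lambda>\<omega>. (\<Sum>i<n. W i \<omega>)\<^sup>2) = real n * v"
    by simp
qed

lemma (in prob_space) central_limit_char:
  fixes W :: "nat \<Rightarrow> 'a \<Rightarrow> real"
  assumes indep: "indep_vars (\<lambda>_. borel) W UNIV"
    and distr: "\<And>i. distr M borel (W i) = \<nu>"
    and sq: "\<And>i. integrable M (\<lambda>\<omega>. (W i \<omega>)\<^sup>2)"
    and mean: "\<And>i. expectation (W i) = 0"
    and var: "\<And>i. expectation (\<lambda>\<omega>. (W i \<omega>)\<^sup>2) = v"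
  shows "(\<lambda>n. CLINT \<omega>|M. iexp ((\<Sum>i<n. W i \<omega>) / sqrt (real n))) \<longlonglongrightarrow> exp (- of_real v / 2)"
proof -
  have W [measurable]: "W i \<in> borel_measurable M" for i
    using indep unfolding indep_vars_def2 by simp
  have "v \<ge> 0"
    unfolding var[of 0, symmetric] by (rule Bochner_Integration.integral_nonneg) simp
  then consider "v = 0" | "v > 0" by linarith
  then show ?thesis
  proof cases
    \<comment> \<open>Projections onto directions in the kernel of the covariance matrix have
      variance 0. They cannot be normalised, but then all W i vanish almost surely.\<close>
    case 1
    have "AE \<omega> in M. W i \<omega> = 0" for i
      using integral_nonneg_eq_0_iff_AE[OF sq[of i]] var[of i] 1 by simp
    then have "AE \<omega> in M. \<forall>i. W i \<omega> = 0" by (simp add: AE_all_countable)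
    then have "(CLINT \<omega>|M. iexp ((\<Sum>i<n. W i \<omega>) / sqrt (real n))) = (CLINT \<omega>|M. 1)" for n
      by (intro integral_cong_AE) auto
    then show ?thesis using 1 by (simp add: prob_space)
  next
    case 2
    define \<sigma> where "\<sigma> = sqrt v"
    have \<sigma>: "\<sigma> > 0" "\<sigma>\<^sup>2 = v" using 2 by (simp_all add: \<sigma>_def)
    let ?T = "\<lambda>n \<omega>. (\<Sum>i<n. W i \<omega>) / sqrt (real n * \<sigma>\<^sup>2)"
    have "weak_conv_m (\<lambda>n. distr M borel (?T n)) std_normal_distribution"
      by (rule central_limit_theorem_zero_mean[OF indep mean \<sigma>(1) sq _ distr]) (simp add: mean var \<sigma>(2))
    \<comment> \<open>The classical theorem divides by \<sigma>; evaluating its characteristic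
      functions at \<sigma> undoes this.\<close>
    then have lim: "(\<lambda>n. char (distr M borel (?T n)) \<sigma>) \<longlonglongrightarrow> char std_normal_distribution \<sigma>"
      by (intro levy_continuity1 real_distribution_distr real_dist_normal_dist) auto
    have "char (distr M borel (?T n)) \<sigma> = (CLINT \<omega>|M. iexp ((\<Sum>i<n. W i \<omega>) / sqrt (real n)))" for n
    proof -
      have "\<sigma> * ?T n \<omega> = (\<Sum>i<n. W i \<omega>) / sqrt (real n)" for \<omega>
        using \<sigma>(1) by (simp add: real_sqrt_mult)
      then show ?thesis unfolding char_def by (subst integral_distr) (simp_all only: , auto)
    qed
    moreover have "char std_normal_distribution \<sigma> = exp (- of_real v / 2)"
      unfolding char_std_normal_distribution \<sigma>(2) by (simp add: exp_of_real[symmetric])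
    ultimately show ?thesis using lim by (simp only:)
  qed
qed

text \<open>The Cramer-Wold device: each projection \<open>W t i\<close> is a scalar i.i.d. sequence
  with mean 0, and its characteristic function at 1 is that of the vector sum at t.\<close>

proposition (in prob_space) multivariate_central_limit_theorem:
  fixes Y :: "nat \<Rightarrow> 'a \<Rightarrow> 'b::euclidean_space"
  assumes indep: "indep_vars (\<lambda>_. borel) Y UNIV"
    and distr: "\<And>i. distr M borel (Y i) = P"
    and sq: "integrable M (\<lambda>\<omega>. (norm (Y 0 \<omega>))\<^sup>2)"
    and m: "m = expectation (Y 0)"
    and N: "prob_space N" "sets N = sets borel"
    and charN: "\<And>t. (CLINT x|N. iexp (t \<bullet> x)) = exp (- of_real (\<integral>\<omega>. (t \<bullet> (Y 0 \<omega> - m))\<^sup>2 \<partial>M) / 2)"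
    and f: "continuous_on UNIV f" "bounded (range f)"
  shows "(\<lambda>n. \<integral>\<omega>. f ((1 / sqrt (real n)) *\<^sub>R (\<Sum>i<n. Y i \<omega> - m)) \<partial>M) \<longlonglongrightarrow> (\<integral>x. f x \<partial>N :: real)"
proof -
  have Y [measurable]: "Y i \<in> borel_measurable M" for i
    using indep unfolding indep_vars_def2 by simp
  have int0: "integrable M (Y 0)"
    using square_integrable_imp_integrable[of "\<lambda>\<omega>. norm (Y 0 \<omega>)"] sq by (simp add: integrable_norm_iff)
  have transfer: "(\<integral>\<omega>. g (Y i \<omega>) \<partial>M) = (\<integral>\<omega>. g (Y 0 \<omega>) \<partial>M)" if "g \<in> borel_measurable borel"
    for i and g :: "'b \<Rightarrow> real"
    using integral_distr[OF Y that, of i] integral_distr[OF Y that, of 0] distr by simp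
  have transfer': "integrable M (\<lambda>\<omega>. g (Y i \<omega>)) \<longleftrightarrow> integrable M (\<lambda>\<omega>. g (Y 0 \<omega>))"
    if "g \<in> borel_measurable borel" for i and g :: "'b \<Rightarrow> real"
    using integrable_distr_eq[OF Y that, of i] integrable_distr_eq[OF Y that, of 0] distr by simp
  define W where "W t i \<omega> = t \<bullet> (Y i \<omega> - m)" for t i \<omega>
  define v where "v t = (\<integral>\<omega>. (t \<bullet> (Y 0 \<omega> - m))\<^sup>2 \<partial>M)" for t
  have W_indep: "indep_vars (\<lambda>_. borel) (W t) UNIV" for t
    unfolding W_def by (rule indep_vars_compose2[OF indep]) simp
  have W_distr: "distr M borel (W t i) = distr P borel (\<lambda>y. t \<bullet> (y - m))" for t i
    unfolding distr[of i, symmetric] W_def by (subst distr_distr) (auto simp: comp_def)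
  have W0sq: "integrable M (\<lambda>\<omega>. (t \<bullet> (Y 0 \<omega> - m))\<^sup>2)" for t
  proof (rule Bochner_Integration.integrable_bound)
    show "integrable M (\<lambda>\<omega>. 2 * (norm t)\<^sup>2 * ((norm (Y 0 \<omega>))\<^sup>2 + (norm m)\<^sup>2))"
      using sq by auto
    have "(t \<bullet> (y - m))\<^sup>2 \<le> 2 * (norm t)\<^sup>2 * ((norm y)\<^sup>2 + (norm m)\<^sup>2)" for y
    proof -
      have "\<bar>t \<bullet> (y - m)\<bar> \<le> norm t * (norm y + norm m)"
        by (rule order_trans[OF Cauchy_Schwarz_ineq2]) (auto intro!: mult_left_mono norm_triangle_ineq4)
      then have "(t \<bullet> (y - m))\<^sup>2 \<le> (norm t * (norm y + norm m))\<^sup>2"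
        by (metis abs_ge_zero power2_abs power_mono)
      also have "\<dots> \<le> (norm t)\<^sup>2 * (2 * ((norm y)\<^sup>2 + (norm m)\<^sup>2))"
        unfolding power_mult_distrib
        using sum_squares_bound[of "norm y" "norm m"]
        by (intro mult_left_mono) (auto simp: power2_sum)
      finally show ?thesis by (simp add: algebra_simps)
    qed
    then show "AE \<omega> in M. norm ((t \<bullet> (Y 0 \<omega> - m))\<^sup>2)
        \<le> norm (2 * (norm t)\<^sup>2 * ((norm (Y 0 \<omega>))\<^sup>2 + (norm m)\<^sup>2))"
      by simp
  qed simp
  have W_sq: "integrable M (\<lambda>\<omega>. (W t i \<omega>)\<^sup>2)" for t i
    unfolding W_def using W0sq[of t] by (subst transfer') auto
  have W_mean: "expectation (W t i) = 0" for t i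
  proof -
    have "expectation (W t i) = (\<integral>\<omega>. t \<bullet> (Y 0 \<omega> - m) \<partial>M)"
      unfolding W_def by (rule transfer) simp
    also have "\<dots> = t \<bullet> (\<integral>\<omega>. Y 0 \<omega> - m \<partial>M)"
      using int0 by (intro integral_inner_right) auto
    also have "(\<integral>\<omega>. Y 0 \<omega> - m \<partial>M) = 0"
      using int0 by (simp add: m prob_space)
    finally show ?thesis by simp
  qed
  have W_var: "expectation (\<lambda>\<omega>. (W t i \<omega>)\<^sup>2) = v t" for t i
    unfolding W_def v_def by (rule transfer) simp
  define Z where "Z n \<omega> = (1 / sqrt (real n)) *\<^sub>R (\<Sum>i<n. Y i \<omega> - m)" for n \<omega>
  have Z [measurable]: "Z n \<in> borel_measurable M" for n unfolding Z_def by measurable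
  have ZW: "t \<bullet> Z n \<omega> = (\<Sum>i<n. W t i \<omega>) / sqrt (real n)" for t n \<omega>
    by (simp add: Z_def W_def inner_sum_right)
  have "(\<lambda>n. \<integral>\<omega>. f (Z n \<omega>) \<partial>M) \<longlonglongrightarrow> (\<integral>x. f x \<partial>N)"
  proof (rule tight_char_tendsto[OF prob_space_axioms N Z _ _ f])
    show "(\<lambda>n. CLINT \<omega>|M. iexp (t \<bullet> Z n \<omega>)) \<longlonglongrightarrow> (CLINT x|N. iexp (t \<bullet> x))" for t
      using central_limit_char[OF W_indep W_distr W_sq W_mean W_var, of t]
      unfolding charN ZW v_def .
  next
    fix e :: real assume e: "e > 0"
    define V where "V = (\<Sum>b\<in>(Basis::'b set). v b)"
    have V: "V \<ge> 0" unfolding V_def v_def by (intro sum_nonneg integral_nonneg) auto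
    \<comment> \<open>For n \<ge> 1 this is an equality; for n = 0 division by sqrt 0 gives 0, which
      is only bounded by \<open>v b\<close>.\<close>
    have second: "integrable M (\<lambda>\<omega>. (b \<bullet> Z n \<omega>)\<^sup>2)" "expectation (\<lambda>\<omega>. (b \<bullet> Z n \<omega>)\<^sup>2) \<le> v b" for b n
      using expectation_sum_squared[OF W_indep W_sq W_mean W_var, of b n]
      by (auto simp: ZW power_divide v_def intro!: integral_nonneg)
    have norm2: "(norm (Z n \<omega>))\<^sup>2 = (\<Sum>b\<in>Basis. (b \<bullet> Z n \<omega>)\<^sup>2)" for n \<omega>
      unfolding power2_norm_eq_inner euclidean_inner[of "Z n \<omega>" "Z n \<omega>"]
      by (simp add: inner_commute power2_eq_square)
    have int2: "integrable M (\<lambda>\<omega>. (norm (Z n \<omega>))\<^sup>2)" for n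
      unfolding norm2 by (intro Bochner_Integration.integrable_sum second)
    have E2: "expectation (\<lambda>\<omega>. (norm (Z n \<omega>))\<^sup>2) \<le> V" for n
      unfolding norm2 V_def using second by (subst Bochner_Integration.integral_sum) (auto intro: sum_mono)
    \<comment> \<open>Markov's inequality leaves V / R^2 = V e / (V + 1) \<le> e; adding 1 keeps R
      positive when V = 0.\<close>
    define R where "R = sqrt ((V + 1) / e)"
    have R: "R > 0" "R\<^sup>2 = (V + 1) / e" using V e by (auto simp: R_def intro: divide_nonneg_pos)
    have "prob {\<omega>\<in>space M. norm (Z n \<omega>) > R} \<le> e" for n
    proof -
      have "prob {\<omega>\<in>space M. norm (Z n \<omega>) > R} \<le> prob {\<omega>\<in>space M. (norm (Z n \<omega>))\<^sup>2 \<ge> R\<^sup>2}"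
        using R(1) by (intro finite_measure_mono subsetI CollectI conjI power_mono) auto
      also have "\<dots> \<le> expectation (\<lambda>\<omega>. (norm (Z n \<omega>))\<^sup>2) / R\<^sup>2"
        using R(1) by (intro integral_Markov_inequality_measure[OF int2, where A="{}"]) auto
      also have "\<dots> \<le> V / R\<^sup>2" using E2 R(1) by (intro divide_right_mono) auto
      also have "\<dots> \<le> e" unfolding R(2) using V e by (simp add: divide_simps)
      finally show ?thesis .
    qed
    then show "\<exists>R. \<forall>n. prob {\<omega>\<in>space M. norm (Z n \<omega>) > R} \<le> e" by blast
  qed
  then show ?thesis by (simp add: Z_def)
qed

section \<open>Gaussian laws with a prescribed, possibly singular, covariance\<close>

lemma gaussian_exists:
  fixes S :: "'b::euclidean_space set" and u :: "'b \<Rightarrow> real"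
  assumes S: "finite S" and u: "\<And>s. s \<in> S \<Longrightarrow> 0 \<le> u s"
  shows "\<exists>N :: 'b measure. prob_space N \<and> sets N = sets borel \<and>
    (\<forall>t. (CLINT x|N. iexp (t \<bullet> x)) = exp (- of_real (\<Sum>s\<in>S. u s * (t \<bullet> s)\<^sup>2) / 2))"
proof -
  let ?G = "\<lambda>_::'b. std_normal_distribution"
  interpret G: prob_space std_normal_distribution by (rule prob_space_normal_density) simp
  interpret P: product_prob_space ?G S by standard
  \<comment> \<open>A linear image of independent standard normals, one for each s in S. The vectors
    s may be linearly dependent or fail to span the space.\<close>
  define h where "h x = (\<Sum>s\<in>S. (sqrt (u s) * x s) *\<^sub>R s)" for x :: "'b \<Rightarrow> real"
  have h [measurable]: "h \<in> borel_measurable (Pi\<^sub>M S ?G)"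
    unfolding h_def by measurable
  have char: "(CLINT x|distr (Pi\<^sub>M S ?G) borel h. iexp (t \<bullet> x)) = exp (- of_real (\<Sum>s\<in>S. u s * (t \<bullet> s)\<^sup>2) / 2)" for t
  proof -
    have "(CLINT x|distr (Pi\<^sub>M S ?G) borel h. iexp (t \<bullet> x)) = (CLINT x|Pi\<^sub>M S ?G. iexp (t \<bullet> h x))"
      by (subst integral_distr) auto
    also have "\<dots> = (CLINT x|Pi\<^sub>M S ?G. \<Prod>s\<in>S. iexp (sqrt (u s) * (t \<bullet> s) * x s))"
      by (simp add: h_def inner_sum_right sum_distrib_left exp_sum[OF S, symmetric] mult_ac)
    also have "\<dots> = (\<Prod>s\<in>S. char std_normal_distribution (sqrt (u s) * (t \<bullet> s)))"
      unfolding char_def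
      by (rule P.product_integral_prod[OF S]) (auto intro!: G.integrable_iexp)
    also have "\<dots> = (\<Prod>s\<in>S. exp (- of_real (u s * (t \<bullet> s)\<^sup>2) / 2))"
    proof (intro prod.cong refl)
      fix s assume "s \<in> S"
      then have "(sqrt (u s) * (t \<bullet> s))\<^sup>2 = u s * (t \<bullet> s)\<^sup>2"
        using u by (simp add: power_mult_distrib)
      then show "char std_normal_distribution (sqrt (u s) * (t \<bullet> s)) = exp (- of_real (u s * (t \<bullet> s)\<^sup>2) / 2)"
        by (simp only: char_std_normal_distribution) (simp add: exp_of_real[symmetric])
    qed
    also have "\<dots> = exp (- of_real (\<Sum>s\<in>S. u s * (t \<bullet> s)\<^sup>2) / 2)"
      by (simp add: exp_sum[OF S, symmetric] sum_negf sum_divide_distrib)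
    finally show ?thesis .
  qed
  moreover have "prob_space (distr (Pi\<^sub>M S ?G) borel h)"
    by (rule P.prob_space_distr) simp
  ultimately show ?thesis by (intro exI[of _ "distr (Pi\<^sub>M S ?G) borel h"]) auto
qed

text \<open>A hyperplane strictly separating S from the mean would separate the mean from itself
  after integration.\<close>

lemma (in prob_space) expectation_in_convex:
  fixes Y :: "'a \<Rightarrow> 'b::euclidean_space"
  assumes int: "integrable M Y" and Y: "AE \<omega> in M. Y \<omega> \<in> S" and S: "convex S" "closed S"
  shows "expectation Y \<in> S"
proof (rule ccontr)
  assume "expectation Y \<notin> S"
  then obtain a b where ab: "a \<bullet> expectation Y < b" "\<And>x. x \<in> S \<Longrightarrow> a \<bullet> x > b"
    using separating_hyperplane_closed_point[OF S] by metis
  have "b \<le> (\<integral>\<omega>. a \<bullet> Y \<omega> \<partial>M)"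
    using Y by (intro integral_ge_const) (use int ab(2) in \<open>auto intro: less_imp_le\<close>)
  also have "\<dots> = a \<bullet> expectation Y" using int by (intro integral_inner_right) auto
  finally show False using ab(1) by simp
qed

text \<open>The second moment matrix lies in the compact convex hull of the matrices \<open>v v\<^sup>T\<close>, hence it
  is a finite convex combination of them; this replaces a square root of the covariance matrix.\<close>

lemma (in prob_space) second_moment_finite_sum:
  fixes Y :: "'a \<Rightarrow> real ^ 'n"
  assumes Y: "Y \<in> borel_measurable M" "AE \<omega> in M. Y \<omega> \<in> S" and S: "compact S"
  obtains T :: "(real ^ 'n) set" and u where "finite T" "\<And>s. s \<in> T \<Longrightarrow> 0 \<le> u s"
    "\<And>t. (\<integral>\<omega>. (t \<bullet> Y \<omega>)\<^sup>2 \<partial>M) = (\<Sum>s\<in>T. u s * (t \<bullet> s)\<^sup>2)"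
proof -
  \<comment> \<open>The rank-one matrix v v^T linearises the square: (t \<bullet> v)^2 becomes a
    linear functional of \<open>A v\<close>, which commutes with the expectation.\<close>
  define A :: "real ^ 'n \<Rightarrow> real ^ 'n ^ 'n" where "A v = (\<chi> r s. v $ r * v $ s)" for v
  have quad: "t \<bullet> (A v *v t) = (t \<bullet> v)\<^sup>2" for t v
    by (simp add: A_def matrix_vector_mult_def inner_vec_def power2_eq_square sum_product sum_distrib_left mult_ac)
  have lin: "bounded_linear (\<lambda>B :: real ^ 'n ^ 'n. t \<bullet> (B *v t))" for t
    unfolding linear_conv_bounded_linear[symmetric]
    by (intro linearI) (auto simp: matrix_vector_mult_add_rdistrib inner_add_right scaleR_matrix_vector_assoc[symmetric])
  have A_cont: "continuous_on UNIV A"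
    unfolding A_def by (intro continuous_intros)
  have comp: "compact (A ` S)"
    by (rule compact_continuous_image[OF continuous_on_subset[OF A_cont] S]) simp
  have A_meas: "(\<lambda>\<omega>. A (Y \<omega>)) \<in> borel_measurable M"
    by (rule measurable_compose[OF Y(1) borel_measurable_continuous_onI[OF A_cont]])
  obtain B where B: "\<And>x. x \<in> A ` S \<Longrightarrow> norm x \<le> B"
    using compact_imp_bounded[OF comp] by (auto simp: bounded_iff)
  have int: "integrable M (\<lambda>\<omega>. A (Y \<omega>))"
    using Y(2) by (intro integrable_const_bound[OF _ A_meas, of B]) (auto intro: B)
  have "expectation (\<lambda>\<omega>. A (Y \<omega>)) \<in> convex hull (A ` S)"
    using Y(2) comp
    by (intro expectation_in_convex[OF int]) (auto intro: hull_inc compact_imp_closed compact_convex_hull)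
  then obtain T' u where T': "finite T'" "T' \<subseteq> A ` S" "\<And>x. x \<in> T' \<Longrightarrow> 0 \<le> u x"
    "expectation (\<lambda>\<omega>. A (Y \<omega>)) = (\<Sum>v\<in>T'. u v *\<^sub>R v)"
    unfolding convex_hull_explicit by clarsimp (metis (no_types))
  \<comment> \<open>v and -v give the same matrix, so one preimage is selected for each matrix of
    the convex combination.\<close>
  obtain T where T: "T \<subseteq> S" "inj_on A T" "T' = A ` T"
    using subset_image_inj[THEN iffD1, OF T'(2)] by auto
  show thesis
  proof
    show "finite T" using T'(1) T by (simp add: finite_image_iff)
    show "0 \<le> (u \<circ> A) s" if "s \<in> T" for s using that T T'(3) by auto
    fix t
    have "(\<integral>\<omega>. (t \<bullet> Y \<omega>)\<^sup>2 \<partial>M) = t \<bullet> (expectation (\<lambda>\<omega>. A (Y \<omega>)) *v t)"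
      unfolding quad[symmetric] by (rule integral_bounded_linear[OF lin int])
    also have "\<dots> = (\<Sum>v\<in>T'. u v *\<^sub>R (t \<bullet> (v *v t)))"
      using linear_sum[OF bounded_linear.linear[OF lin], of t "\<lambda>v. u v *\<^sub>R v" T']
        linear_cmul[OF bounded_linear.linear[OF lin], of t] unfolding T'(4) by simp
    also have "\<dots> = (\<Sum>s\<in>T. (u \<circ> A) s * (t \<bullet> s)\<^sup>2)"
      unfolding T(3) sum.reindex[OF T(2)] by (simp add: quad)
    finally show "(\<integral>\<omega>. (t \<bullet> Y \<omega>)\<^sup>2 \<partial>M) = (\<Sum>s\<in>T. (u \<circ> A) s * (t \<bullet> s)\<^sup>2)" .
  qed
qed


section \<open>Angles between permuted weight vectors\<close>

lemma angle_nonneg: "0 \<le> angle x y" and angle_le_pi: "angle x y \<le> pi"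
proof -
  have "\<bar>x \<bullet> y / (norm x * norm y)\<bar> \<le> 1"
    using Cauchy_Schwarz_ineq2[of x y] by (auto simp: abs_mult divide_le_eq_1)
  then show "0 \<le> angle x y" "angle x y \<le> pi"
    unfolding angle_def abs_le_iff by (auto intro!: arccos_lbound arccos_ubound)
qed

lemma cos_angle: "norm x * norm y * cos (angle x y) = x \<bullet> y"
proof (cases "x = 0 \<or> y = 0")
  case False
  have "\<bar>x \<bullet> y / (norm x * norm y)\<bar> \<le> 1"
    using Cauchy_Schwarz_ineq2[of x y] by (auto simp: abs_mult divide_le_eq_1)
  then have "cos (angle x y) = x \<bullet> y / (norm x * norm y)"
    unfolding angle_def by (intro cos_arccos_abs)
  then show ?thesis using False by simp
qed auto

lemma angle_commute: "angle x y = angle y x"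
  by (simp add: angle_def inner_commute mult.commute)

lemma cos_angle_sgn: "x \<noteq> 0 \<Longrightarrow> y \<noteq> 0 \<Longrightarrow> cos (angle x y) = sgn x \<bullet> sgn y"
  using cos_angle[of x y] by (simp add: sgn_div_norm field_simps)

text \<open>Removing from \<open>sgn x\<close> and \<open>sgn z\<close> their components along
  \<open>sgn y\<close> leaves vectors u, v of norms sin \<alpha> and sin \<beta>, and Cauchy-Schwarz
  for u, v compares cos(\<alpha> + \<beta>) with the cosine of the outer angle. Equality makes u and
  v point in opposite directions; the resulting relation divides by no sine and so also covers
  collinear vectors.\<close>

lemma
  fixes x y z :: "'a::real_inner"
  assumes nz: "x \<noteq> 0" "y \<noteq> 0" "z \<noteq> 0"
  shows angle_triangle: "angle x z \<le> angle x y + angle y z" (is ?le)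
    and angle_triangle_eq: "angle x z = angle x y + angle y z \<Longrightarrow>
      sin (angle y z) *\<^sub>R sgn x + sin (angle x y) *\<^sub>R sgn z = sin (angle x z) *\<^sub>R sgn y"
proof -
  define \<alpha> \<beta> where "\<alpha> = angle x y" and "\<beta> = angle y z"
  define u v where "u = sgn x - cos \<alpha> *\<^sub>R sgn y" and "v = sgn z - cos \<beta> *\<^sub>R sgn y"
  have unit: "sgn x \<bullet> sgn x = 1" "sgn y \<bullet> sgn y = 1" "sgn z \<bullet> sgn z = 1"
    using nz by (simp_all add: dot_square_norm norm_sgn)
  have c: "sgn x \<bullet> sgn y = cos \<alpha>" "sgn y \<bullet> sgn x = cos \<alpha>" "sgn y \<bullet> sgn z = cos \<beta>"
    "sgn z \<bullet> sgn y = cos \<beta>"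
    using nz by (simp_all add: cos_angle_sgn \<alpha>_def \<beta>_def inner_commute)
  have bounds: "0 \<le> \<alpha>" "\<alpha> \<le> pi" "0 \<le> \<beta>" "\<beta> \<le> pi"
    by (simp_all add: \<alpha>_def \<beta>_def angle_nonneg angle_le_pi)
  have "u \<bullet> u = (sin \<alpha>)\<^sup>2" "v \<bullet> v = (sin \<beta>)\<^sup>2"
    by (simp_all add: u_def v_def inner_diff_left inner_diff_right unit c sin_squared_eq flip: power2_eq_square)
  then have norms: "norm u = sin \<alpha>" "norm v = sin \<beta>"
    using bounds by (simp_all add: norm_eq_sqrt_inner real_sqrt_abs sin_ge_zero)
  have uv: "u \<bullet> v = cos (angle x z) - cos \<alpha> * cos \<beta>"
    using nz by (simp add: u_def v_def inner_diff_left inner_diff_right unit c cos_angle_sgn)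
  have "- (sin \<alpha> * sin \<beta>) \<le> u \<bullet> v"
    using Cauchy_Schwarz_ineq2[of u v] norms by (simp add: abs_le_iff)
  then have cos_le: "cos (\<alpha> + \<beta>) \<le> cos (angle x z)"
    by (simp add: uv cos_add)
  show ?le
  proof (rule ccontr)
    assume "\<not> ?le"
    then have "\<alpha> + \<beta> < angle x z" by (simp add: \<alpha>_def \<beta>_def)
    then have "cos (angle x z) < cos (\<alpha> + \<beta>)"
      using bounds by (intro cos_monotone_0_pi) (auto simp: angle_le_pi)
    with cos_le show False by simp
  qed
  show "sin (angle y z) *\<^sub>R sgn x + sin (angle x y) *\<^sub>R sgn z = sin (angle x z) *\<^sub>R sgn y"
    if eq: "angle x z = angle x y + angle y z"
  proof -
    have "u \<bullet> (- v) = norm u * norm (- v)"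
      unfolding norms norm_minus_cancel using uv eq by (simp add: cos_add \<alpha>_def \<beta>_def)
    then have "norm u *\<^sub>R (- v) = norm (- v) *\<^sub>R u"
      by (simp only: norm_cauchy_schwarz_eq)
    then have "sin \<beta> *\<^sub>R u + sin \<alpha> *\<^sub>R v = 0"
      by (simp add: norms) (metis add.commute neg_eq_iff_add_eq_0)
    then have "sin \<beta> *\<^sub>R sgn x + sin \<alpha> *\<^sub>R sgn z = (sin \<alpha> * cos \<beta> + cos \<alpha> * sin \<beta>) *\<^sub>R sgn y"
      by (simp add: u_def v_def algebra_simps)
    then show ?thesis using eq by (simp add: \<alpha>_def \<beta>_def sin_add)
  qed
qed

section \<open>Linearity and isometry of the action, and an invariant functional\<close>

lemma act_zero [simp]: "act \<sigma> 0 = 0"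
  by (simp add: act_def vec_eq_iff)

lemma act_scaleR: "act \<sigma> (c *\<^sub>R x) = c *\<^sub>R act \<sigma> x"
  by (simp add: act_def vec_eq_iff)

lemma act_add: "act \<sigma> (x + y) = act \<sigma> x + act \<sigma> y"
  by (simp add: act_def vec_eq_iff)

lemma bounded_linear_act: "bounded_linear (act \<sigma>)"
  unfolding linear_conv_bounded_linear[symmetric]
  by (intro linearI act_add act_scaleR)

lemma inner_act: "\<sigma> \<in> perms \<Longrightarrow> act \<sigma> x \<bullet> act \<sigma> y = x \<bullet> y"
  unfolding dot_norm_neg by (simp add: norm_act flip: act_diff)

lemma angle_act: "\<sigma> \<in> perms \<Longrightarrow> angle (act \<sigma> x) (act \<sigma> y) = angle x y"
  by (simp add: angle_def inner_act norm_act)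

lemma act_eq_zero_iff: "\<sigma> \<in> perms \<Longrightarrow> act \<sigma> x = 0 \<longleftrightarrow> x = 0"
  by (metis norm_act norm_eq_zero)

text \<open>A linear functional that is constant on orbits and positive on nonzero vectors of the
  orthant: it turns relations between vectors and their permuted copies into scalar
  equations.\<close>

definition total_weight :: "('v::card2) weights \<Rightarrow> real" where
  "total_weight x = (\<Sum>e\<in>UNIV. x $ e)"

lemma total_weight_act:
  assumes "\<sigma> \<in> perms"
  shows "total_weight (act \<sigma> x) = total_weight x"
proof -
  have c: "inv \<sigma> \<circ> \<sigma> = id" "\<sigma> \<circ> inv \<sigma> = id"
    using assms unfolding perms_def by (auto dest: permutes_inv_o)
  have "bij (edge_image (inv \<sigma>) :: 'a edge \<Rightarrow> 'a edge)"
    by (rule bij_betw_byWitness[where f'="edge_image \<sigma>"])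
       (simp_all add: edge_image_comp assms inv_in_perms c)
  then show ?thesis
    unfolding total_weight_def act_def
    by (simp add: sum.reindex_bij_betw[where g="\<lambda>e. x $ e"])
qed

lemma total_weight_linear:
  "total_weight (x + y) = total_weight x + total_weight y"
  "total_weight (c *\<^sub>R x) = c * total_weight x"
  by (simp_all add: total_weight_def sum.distrib sum_distrib_left)

lemma total_weight_pos:
  assumes "x \<in> orthant" "x \<noteq> 0"
  shows "total_weight x > 0"
proof -
  obtain e where "x $ e \<noteq> 0" using assms(2) by (auto simp: vec_eq_iff)
  then show ?thesis
    using assms(1) unfolding total_weight_def orthant_def
    by (intro sum_pos2[of _ e]) (auto simp: less_le)
qed

lemma sgn_act: "\<sigma> \<in> perms \<Longrightarrow> sgn (act \<sigma> x) = act \<sigma> (sgn x)"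
  by (simp add: sgn_div_norm norm_act act_scaleR)

section \<open>The minimal angle of a distinct vector\<close>

lemma nontrivial_perm: "\<exists>\<sigma>\<in>(perms :: ('v::card2 \<Rightarrow> 'v) set). \<sigma> \<noteq> id"
proof -
  obtain S :: "'v set" where "card S = 2"
    using obtain_subset_with_card_n[OF two_le_card[where 'a='v]] by metis
  then obtain a b :: 'v where ab: "a \<noteq> b" by (auto simp: card_2_iff)
  have "Transposition.transpose a b \<in> perms" by (simp add: perms_def permutes_swap_id)
  moreover have "Transposition.transpose a b \<noteq> id"
    using ab by (metis id_apply transpose_apply_first)
  ultimately show ?thesis by blast
qed

lemma distinct_weights_nonzero: "distinct_weights w \<Longrightarrow> w \<noteq> 0"
  using nontrivial_perm act_zero unfolding distinct_weights_def by blast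

lemma finite_angles: "finite {angle w (act \<sigma> w) | \<sigma>. \<sigma> \<in> perms \<and> \<sigma> \<noteq> id}"
  by (rule finite_subset[of _ "(\<lambda>\<sigma>. angle w (act \<sigma> w)) ` perms"]) auto

lemma min_angle_le: "\<sigma> \<in> perms \<Longrightarrow> \<sigma> \<noteq> id \<Longrightarrow> min_angle w \<le> angle w (act \<sigma> w)"
  unfolding min_angle_def by (intro Min_le finite_angles) blast

text \<open>A minimum over a finite nonempty set is attained. Angle 0 makes w and its image
  parallel, and since their norms agree, equal.\<close>

lemma min_angle_pos:
  assumes w: "distinct_weights w"
  shows "min_angle w > 0"
proof -
  let ?A = "{angle w (act \<sigma> w) | \<sigma>. \<sigma> \<in> perms \<and> \<sigma> \<noteq> id}"
  have "?A \<noteq> {}" using nontrivial_perm by blast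
  then have "min_angle w \<in> ?A"
    unfolding min_angle_def by (rule Min_in[OF finite_angles])
  then obtain \<sigma> where \<sigma>: "\<sigma> \<in> perms" "\<sigma> \<noteq> id" "min_angle w = angle w (act \<sigma> w)" by blast
  have "angle w (act \<sigma> w) \<noteq> 0"
  proof
    assume "angle w (act \<sigma> w) = 0"
    then have "w \<bullet> act \<sigma> w = norm w * norm (act \<sigma> w)" using cos_angle[of w "act \<sigma> w"] by simp
    then have "norm w *\<^sub>R act \<sigma> w = norm (act \<sigma> w) *\<^sub>R w" by (simp only: norm_cauchy_schwarz_eq)
    then have "act \<sigma> w = w"
      using \<sigma>(1) distinct_weights_nonzero[OF w] by (simp add: norm_act)
    then show False using w \<sigma> unfolding distinct_weights_def by blast
  qed
  then show ?thesis using \<sigma>(3) angle_nonneg[of w "act \<sigma> w"] by linarith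
qed

text \<open>The chain \<open>w, y, \<sigma>x, \<sigma>w\<close> of angles gives the weak inequality.  In the case of a tie these
  vectors lie on one great circle in this order, and comparing the \<open>\<sigma>\<close>-invariant
  \<^const>\<open>total_weight\<close> of the resulting linear relations contradicts positivity.\<close>

proposition inner_act_less:
  assumes w: "distinct_weights w"
    and x: "x \<in> cone_about w (min_angle w / 4)" "x \<noteq> 0"
    and y: "y \<in> cone_about w (min_angle w / 4)" "y \<noteq> 0"
    and \<sigma>: "\<sigma> \<in> perms" "\<sigma> \<noteq> id"
  shows "act \<sigma> x \<bullet> y < x \<bullet> y"
proof -
  define b where "b = min_angle w / 4"
  have w0: "w \<noteq> 0" by (rule distinct_weights_nonzero[OF w])
  have nz: "act \<sigma> x \<noteq> 0" "act \<sigma> w \<noteq> 0" using \<sigma> x w0 by (simp_all add: act_eq_zero_iff)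
  have b: "b > 0" "4 * b \<le> angle w (act \<sigma> w)" "4 * b \<le> pi"
    using min_angle_pos[OF w] min_angle_le[OF \<sigma>, of w] angle_le_pi[of w "act \<sigma> w"] by (auto simp: b_def)
  have xw: "angle x w \<le> b" and yw: "angle y w \<le> b"
    using x y by (auto simp: cone_about_def b_def)
  have s: "angle (act \<sigma> x) (act \<sigma> w) = angle x w" by (rule angle_act[OF \<sigma>(1)])
  have "angle x y < angle (act \<sigma> x) y"
  proof (rule ccontr)
    assume "\<not> ?thesis"
    then have tie: "angle (act \<sigma> x) y \<le> angle x y" by simp
    note tri = angle_triangle[OF x(2) w0 y(2)] angle_triangle[OF w0 y(2) nz(1)]
      angle_triangle[OF w0 nz(1) nz(2)] angle_triangle[OF nz(2) nz(1) y(2)] angle_triangle[OF nz(2) y(2) w0]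
    note com = angle_commute[of w y] angle_commute[of y "act \<sigma> x"] angle_commute[of "act \<sigma> w" "act \<sigma> x"]
      angle_commute[of "act \<sigma> w" w]
    \<comment> \<open>The tie gives 4b \<le> angle(w, \<sigma>w) \<le> angle(w, y) + angle(y,
      \<sigma>x) + angle(\<sigma>x, \<sigma>w) \<le> b + 2b + b, so every inequality involved is an
      equality.\<close>
    have e: "angle x w = b" "angle w y = b" "angle x y = 2 * b" "angle y (act \<sigma> x) = 2 * b"
      "angle w (act \<sigma> x) = 3 * b" "angle (act \<sigma> w) y = 3 * b" "angle (act \<sigma> w) (act \<sigma> x) = b"
      "angle (act \<sigma> x) y = 2 * b"
      using tri com tie b xw yw s by linarith+
    define X Y W where "X = total_weight (sgn x)" and "Y = total_weight (sgn y)" and "W = total_weight (sgn w)"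
    have tw: "total_weight (sgn (act \<sigma> x)) = X" "total_weight (sgn (act \<sigma> w)) = W"
      by (simp_all add: sgn_act \<sigma> total_weight_act X_def W_def)
    have "sin b * X + sin b * Y = sin (2 * b) * W"
      using arg_cong[OF angle_triangle_eq[OF x(2) w0 y(2)], of total_weight] e
      by (simp add: total_weight_linear X_def Y_def W_def)
    moreover have "sin (2 * b) * W + sin b * X = sin (3 * b) * Y"
      using arg_cong[OF angle_triangle_eq[OF w0 y(2) nz(1)], of total_weight] e
      by (simp add: total_weight_linear tw) (simp add: Y_def W_def)
    moreover have "sin (2 * b) * W + sin b * Y = sin (3 * b) * X"
      using arg_cong[OF angle_triangle_eq[OF nz(2) nz(1) y(2)], of total_weight] e
      by (simp add: total_weight_linear tw) (simp add: Y_def)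
    ultimately have rel: "sin b * X + sin b * Y + sin b * X = sin (3 * b) * Y"
      "sin b * X + sin b * Y + sin b * Y = sin (3 * b) * X" by simp_all
    have sb: "sin b > 0" "sin (3 * b) > 0" using b by (auto intro!: sin_gt_zero)
    \<comment> \<open>The difference of the two relations forces X = Y. Either of them then says 3
      sin b = sin 3b, against sin 3b = 3 sin b - 4 (sin b)^3 with sin b > 0.\<close>
    have "(sin b + sin (3 * b)) * (X - Y) = 0" using rel by (simp add: algebra_simps)
    then have XY: "X = Y" using sb by simp
    have "sgn x \<in> orthant" using x(1) by (simp add: cone_about_def orthant_def sgn_div_norm)
    then have "X > 0" unfolding X_def using x(2) by (intro total_weight_pos) (auto simp: sgn_zero_iff)
    moreover have "(3 * sin b - sin (3 * b)) * X = 0" using rel(1) XY by (simp add: algebra_simps)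
    ultimately have "3 * sin b = sin (3 * b)" by simp
    moreover have "sin (3 * b) = 3 * sin b - 4 * sin b ^ 3"
    proof -
      have "sin (3 * b) = 2 * sin b * (cos b * cos b) + (1 - 2 * (sin b)\<^sup>2) * sin b"
        using sin_add[of "2 * b" b] by (simp add: sin_double cos_double_sin)
      also have "cos b * cos b = 1 - (sin b)\<^sup>2"
        by (simp add: cos_squared_eq flip: power2_eq_square)
      finally show ?thesis by (simp add: algebra_simps power2_eq_square power3_eq_cube)
    qed
    ultimately show False using sb by simp
  qed
  then have "cos (angle (act \<sigma> x) y) < cos (angle x y)"
    by (intro cos_monotone_0_pi) (auto simp: angle_nonneg angle_le_pi)
  then have "norm x * norm y * cos (angle (act \<sigma> x) y) < norm x * norm y * cos (angle x y)"
    using x y by simp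
  then show ?thesis using cos_angle[of "act \<sigma> x" y] cos_angle[of x y] by (simp add: norm_act \<sigma>)
qed

lemma inner_act_le:
  assumes "distinct_weights w" "x \<in> cone_about w (min_angle w / 4)" "y \<in> cone_about w (min_angle w / 4)"
    "\<sigma> \<in> perms"
  shows "act \<sigma> x \<bullet> y \<le> x \<bullet> y"
  using inner_act_less[OF assms(1,2) _ assms(3) _ assms(4)]
  by (cases "x = 0 \<or> y = 0 \<or> \<sigma> = id") (auto intro: less_imp_le)


section \<open>Frechet means of distributions in the cone\<close>

definition max_inner :: "('v::card2) weights \<Rightarrow> 'v weights \<Rightarrow> real" where
  "max_inner z x = Max ((\<lambda>\<sigma>. act \<sigma> z \<bullet> x) ` perms)"

lemma perms_nonempty: "perms \<noteq> {}"
  using id_in_perms by blast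

lemma max_inner_ge: "\<sigma> \<in> perms \<Longrightarrow> act \<sigma> z \<bullet> x \<le> max_inner z x"
  unfolding max_inner_def by (intro Max_ge) auto

lemma max_inner_attained: "\<exists>\<sigma>\<in>perms. act \<sigma> z \<bullet> x = max_inner z x"
proof -
  have "max_inner z x \<in> (\<lambda>\<sigma>. act \<sigma> z \<bullet> x) ` perms"
    unfolding max_inner_def using perms_nonempty by (intro Max_in) auto
  then show ?thesis by auto
qed

lemma max_inner_eqI:
  assumes "\<And>\<sigma>. \<sigma> \<in> perms \<Longrightarrow> act \<sigma> z \<bullet> x \<le> z \<bullet> x"
  shows "max_inner z x = z \<bullet> x"
  using max_inner_attained[of z x] max_inner_ge[OF id_in_perms, of z x] assms by force

lemma dist_act_squared:
  assumes "\<sigma> \<in> perms"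
  shows "(dist (act \<sigma> z) x)\<^sup>2 = (norm z)\<^sup>2 + (norm x)\<^sup>2 - 2 * (act \<sigma> z \<bullet> x)"
  using dot_norm_neg[of "act \<sigma> z" x] assms by (simp add: dist_norm norm_act)

text \<open>Permutations preserve norms, so minimising the distance means maximising the inner
  product; by isometry the pair of permutations reduces to the single one
  \<open>inv t \<circ> s\<close>.\<close>

lemma dist_q_squared:
  assumes z: "z \<in> orthant" and x: "x \<in> orthant"
  shows "(dist (q z) (q x))\<^sup>2 = (norm z)\<^sup>2 + (norm x)\<^sup>2 - 2 * max_inner z x"
proof (rule antisym)
  obtain \<sigma> where \<sigma>: "\<sigma> \<in> perms" "act \<sigma> z \<bullet> x = max_inner z x"
    using max_inner_attained by blast
  have "dist (q z) (q x) \<le> dist (act \<sigma> z) x"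
    using procrustes_le[OF \<sigma>(1) id_in_perms, of z x] by (simp add: dist_q_aux z x)
  then have "(dist (q z) (q x))\<^sup>2 \<le> (dist (act \<sigma> z) x)\<^sup>2" by (intro power_mono) auto
  then show "(dist (q z) (q x))\<^sup>2 \<le> (norm z)\<^sup>2 + (norm x)\<^sup>2 - 2 * max_inner z x"
    by (simp only: dist_act_squared[OF \<sigma>(1)] \<sigma>(2))
next
  obtain s t where st: "s \<in> perms" "t \<in> perms" "procrustes z x = dist (act s z) (act t x)"
    by (rule procrustes_attained)
  define r where "r = inv t \<circ> s"
  have r: "r \<in> perms" unfolding r_def using st by (intro comp_in_perms inv_in_perms)
  have "act t (act r z) = act s z"
    unfolding r_def using st by (simp add: inv_in_perms flip: act_act)
  then have "dist (act s z) (act t x) = dist (act r z) x"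
    using dist_act[OF st(2), of "act r z" x] by simp
  then have "(dist (q z) (q x))\<^sup>2 = (dist (act r z) x)\<^sup>2"
    using st(3) by (simp add: dist_q_aux z x)
  then show "(norm z)\<^sup>2 + (norm x)\<^sup>2 - 2 * max_inner z x \<le> (dist (q z) (q x))\<^sup>2"
    using max_inner_ge[OF r, of z x] by (simp only: dist_act_squared[OF r])
qed

text \<open>Several permutations may be optimal. Taking the first optimal one in a fixed enumeration
  is a measurable choice; its inverse moves the sample point x while z stays fixed.\<close>

lemma measurable_aligning_perm:
  fixes z :: "('v::card2) weights"
  obtains \<tau> where "\<And>x. \<tau> x \<in> perms" "\<And>x. act (\<tau> x) z \<bullet> x = max_inner z x"
    "(\<lambda>x. act (inv (\<tau> x)) x) \<in> borel_measurable borel"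
proof -
  obtain ps where ps: "set ps = (perms :: ('v \<Rightarrow> 'v) set)"
    using finite_list[OF finite_perms] by blast
  define P where "P k x \<longleftrightarrow> k < length ps \<and> act (ps ! k) z \<bullet> x = max_inner z x" for k x
  define n where "n x = (LEAST k. P k x)" for x
  have P: "P (n x) x" for x
  proof -
    obtain \<sigma> where "\<sigma> \<in> set ps" "act \<sigma> z \<bullet> x = max_inner z x"
      using max_inner_attained[of z x] ps by blast
    then have "\<exists>k. P k x" by (auto simp: P_def in_set_conv_nth)
    then show ?thesis unfolding n_def by (rule LeastI_ex)
  qed
  have max_meas [measurable]: "(\<lambda>x. max_inner z x) \<in> borel_measurable borel"
    unfolding max_inner_def by (intro borel_measurable_Max finite_perms) auto
  have n_meas: "n \<in> measurable borel (count_space UNIV)"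
    unfolding n_def P_def by measurable
  have "(\<lambda>x. act (inv (ps ! n x)) x) \<in> borel_measurable borel"
    by (rule measurable_compose_countable[OF _ n_meas])
       (intro borel_measurable_continuous_onI linear_continuous_on bounded_linear_act)
  moreover have "ps ! n x \<in> perms" for x
    using P[of x] nth_mem[of "n x" ps] unfolding P_def ps by blast
  moreover have "act (ps ! n x) z \<bullet> x = max_inner z x" for x using P[of x] by (simp add: P_def)
  ultimately show thesis by (intro that)
qed

text \<open>Let \<open>T\<close> be the sample point \<open>Y\<close> aligned with \<open>z\<close>.  Then
  \<open>E d\<^sub>P(z, Y)\<^sup>2 = |z - E T|\<^sup>2 + E |Y|\<^sup>2 - |E T|\<^sup>2\<close>, and \<open>|E T|\<^sup>2\<close> is the double integral of
  \<open>T \<bullet> T'\<close> over two independent copies, which \<open>inner_act_le\<close> bounds by \<open>|E Y|\<^sup>2\<close>.\<close>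

proposition (in prob_space) frechet_functional:
  fixes Y :: "'a \<Rightarrow> ('v::card2) weights"
  assumes w: "distinct_weights w"
    and K': "compact K'" "convex K'" "K' \<subseteq> cone_about w (min_angle w / 4)"
    and Y: "Y \<in> borel_measurable M" "AE \<omega> in M. Y \<omega> \<in> K'"
  defines "m \<equiv> expectation Y" and "J \<equiv> \<lambda>p. (\<integral>\<omega>. (dist p (q (Y \<omega>)))\<^sup>2 \<partial>M)"
  shows frechet_functional_mean: "m \<in> K'"
    and frechet_functional_integrable: "integrable M (\<lambda>\<omega>. (dist p (q (Y \<omega>)))\<^sup>2)"
    and frechet_functional_le: "J (q m) \<le> J p"
    and frechet_functional_eq: "J p \<le> J (q m) \<Longrightarrow> p = q m"
proof -
  note [measurable] = Y(1)
  have cone: "x \<in> cone_about w (min_angle w / 4)" if "x \<in> K'" for x using that K'(3) by blast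
  have orth: "x \<in> orthant" if "x \<in> K'" for x using cone[OF that] by (simp add: cone_about_def)
  obtain B where B: "\<And>x. x \<in> K' \<Longrightarrow> norm x \<le> B"
    using compact_imp_bounded[OF K'(1)] by (auto simp: bounded_iff)
  have int_Y: "integrable M Y"
    using Y by (intro integrable_const_bound[of _ B]) (auto intro: B)
  have int_Y2: "integrable M (\<lambda>\<omega>. (norm (Y \<omega>))\<^sup>2)"
    using Y by (intro integrable_const_bound[of _ "B\<^sup>2"]) (auto intro!: power_mono B)
  show m: "m \<in> K'"
    unfolding m_def using expectation_in_convex[OF int_Y Y(2) K'(2) compact_imp_closed[OF K'(1)]] .
  have main: "integrable M (\<lambda>\<omega>. (dist (q z) (q (Y \<omega>)))\<^sup>2) \<and> J (q m) \<le> J (q z) \<and>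
      (J (q z) \<le> J (q m) \<longrightarrow> q z = q m)" if z: "z \<in> orthant" for z
  proof -
    obtain \<tau> where \<tau>: "\<And>x. \<tau> x \<in> perms" "\<And>x. act (\<tau> x) z \<bullet> x = max_inner z x"
      "(\<lambda>x. act (inv (\<tau> x)) x) \<in> borel_measurable borel"
      by (rule measurable_aligning_perm[of z]) (rule that)
    define T where "T x = act (inv (\<tau> x)) x" for x
    have T_meas [measurable]: "T \<in> borel_measurable borel" using \<tau>(3) by (simp add: T_def[abs_def])
    have norm_T: "norm (T x) = norm x" for x by (simp add: T_def norm_act inv_in_perms \<tau>(1))
    have inner_T: "z \<bullet> T x = max_inner z x" for x
      using inner_act[OF \<tau>(1), of x z "T x"] \<tau> by (simp add: T_def)
    have int_T: "integrable M (\<lambda>\<omega>. T (Y \<omega>))"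
      using Y by (intro integrable_const_bound[of _ B]) (auto intro: B simp: norm_T)
    define t where "t = expectation (\<lambda>\<omega>. T (Y \<omega>))"
    define E where "E = expectation (\<lambda>\<omega>. (norm (Y \<omega>))\<^sup>2)"
    have dz: "AE \<omega> in M. (dist (q z) (q (Y \<omega>)))\<^sup>2 = (norm z)\<^sup>2 + (norm (Y \<omega>))\<^sup>2 - 2 * (z \<bullet> T (Y \<omega>))"
      using Y(2) by eventually_elim (simp add: dist_q_squared z orth inner_T)
    have dm: "AE \<omega> in M. (dist (q m) (q (Y \<omega>)))\<^sup>2 = (norm m)\<^sup>2 + (norm (Y \<omega>))\<^sup>2 - 2 * (m \<bullet> Y \<omega>)"
      using Y(2)
    proof eventually_elim
      case (elim \<omega>)
      have "max_inner m (Y \<omega>) = m \<bullet> Y \<omega>"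
        by (intro max_inner_eqI inner_act_le[OF w] cone m elim)
      then show ?case by (simp add: dist_q_squared m orth elim)
    qed
    have d_meas: "(\<lambda>\<omega>. (dist p (q (Y \<omega>)))\<^sup>2) \<in> borel_measurable M" for p
    proof -
      have "(\<lambda>y. dist p y) \<in> borel_measurable borel"
        by (intro borel_measurable_continuous_onI continuous_intros)
      from measurable_compose[OF measurable_compose[OF Y(1) measurable_q] this] show ?thesis
        by (rule borel_measurable_power)
    qed
    have int_fz: "integrable M (\<lambda>\<omega>. (norm z)\<^sup>2 + (norm (Y \<omega>))\<^sup>2 - 2 * (z \<bullet> T (Y \<omega>)))"
      using int_Y2 int_T by auto
    have intz: "integrable M (\<lambda>\<omega>. (dist (q z) (q (Y \<omega>)))\<^sup>2)"
      by (rule integrable_cong_AE_imp[OF int_fz d_meas]) (use dz in eventually_elim, simp)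
    have zt: "(\<integral>\<omega>. z \<bullet> T (Y \<omega>) \<partial>M) = z \<bullet> t" and mm: "(\<integral>\<omega>. m \<bullet> Y \<omega> \<partial>M) = m \<bullet> m"
      using int_T int_Y by (simp_all add: t_def m_def)
    have "J (q z) = (\<integral>\<omega>. (norm z)\<^sup>2 + (norm (Y \<omega>))\<^sup>2 - 2 * (z \<bullet> T (Y \<omega>)) \<partial>M)"
      unfolding J_def by (rule integral_cong_AE) (use dz d_meas in auto)
    also have "\<dots> = (norm z)\<^sup>2 + E - 2 * (z \<bullet> t)"
      using int_Y2 int_T by (simp add: E_def prob_space zt del: integral_inner_right)
    finally have Jz: "J (q z) = (norm z)\<^sup>2 + E - 2 * (z \<bullet> t)" .
    have "J (q m) = (\<integral>\<omega>. (norm m)\<^sup>2 + (norm (Y \<omega>))\<^sup>2 - 2 * (m \<bullet> Y \<omega>) \<partial>M)"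
      unfolding J_def by (rule integral_cong_AE) (use dm d_meas in auto)
    also have "\<dots> = (norm m)\<^sup>2 + E - 2 * (m \<bullet> m)"
      using int_Y2 int_Y by (simp add: E_def prob_space mm del: integral_inner_right)
    finally have Jm: "J (q m) = E - m \<bullet> m" by (simp add: power2_norm_eq_inner)
    have zt2: "(norm (z - t))\<^sup>2 = (norm z)\<^sup>2 - 2 * (z \<bullet> t) + t \<bullet> t"
      by (simp add: power2_norm_eq_inner inner_diff_left inner_diff_right inner_commute)
    \<comment> \<open>The double integral with one copy integrated out: \<open>D x\<close> is the
      mean of x \<bullet> Y - T x \<bullet> T Y, and its own mean is m \<bullet> m - t \<bullet>
      t.\<close>
    define D where "D x = m \<bullet> x - t \<bullet> T x" for x
    have T_inner_le: "T x \<bullet> T y \<le> x \<bullet> y" and T_inner_eq: "x \<noteq> 0 \<Longrightarrow> T x \<bullet> T y = x \<bullet> y \<Longrightarrow> T y = act (inv (\<tau> x)) y"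
      if xy: "x \<in> K'" "y \<in> K'" for x y
    proof -
      \<comment> \<open>Applying \<tau> y to both vectors turns T x \<bullet> T y into (r x)
        \<bullet> y, an inner product to which the cone estimate applies. For nonzero x, y equality
        forces r = id, so that both points are aligned by the same permutation.\<close>
      define r where "r = \<tau> y \<circ> inv (\<tau> x)"
      have r: "r \<in> perms" unfolding r_def by (intro comp_in_perms inv_in_perms \<tau>(1))
      have eq: "T x \<bullet> T y = act r x \<bullet> y"
        using inner_act[OF \<tau>(1), of y "T x" "T y"] \<tau>(1)
        by (simp add: T_def r_def inv_in_perms flip: act_act)
      then show "T x \<bullet> T y \<le> x \<bullet> y" using inner_act_le[OF w cone cone r] xy by simp
      show "T y = act (inv (\<tau> x)) y" if x0: "x \<noteq> 0" and tie: "T x \<bullet> T y = x \<bullet> y"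
      proof (cases "y = 0")
        case False
        have "r = id"
          using inner_act_less[OF w cone[OF xy(1)] x0 cone[OF xy(2)] False r] tie eq by force
        then have "\<tau> y = \<tau> x"
          unfolding r_def using perms_bij[OF \<tau>(1), of x]
          by (metis bij_is_inj comp_assoc comp_id id_comp inv_o_cancel)
        then show ?thesis by (simp add: T_def)
      qed (simp add: T_def)
    qed
    have D_eq: "D x = (\<integral>\<omega>. x \<bullet> Y \<omega> - T x \<bullet> T (Y \<omega>) \<partial>M)" for x
      using int_Y int_T by (simp add: D_def m_def t_def inner_commute)
    have D_nonneg: "D x \<ge> 0" if "x \<in> K'" for x
      unfolding D_eq using Y(2) by (intro integral_nonneg_AE) (auto intro: T_inner_le that)
    have int_D: "integrable M (\<lambda>\<omega>. D (Y \<omega>))"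
      unfolding D_def using int_Y int_T by auto
    have E_D: "expectation (\<lambda>\<omega>. D (Y \<omega>)) = m \<bullet> m - t \<bullet> t"
      unfolding D_def using int_Y int_T by (simp add: t_def m_def)
    have D_AE: "AE \<omega> in M. D (Y \<omega>) \<ge> 0" using Y(2) by eventually_elim (rule D_nonneg)
    have tm: "t \<bullet> t \<le> m \<bullet> m" using integral_nonneg_AE[OF D_AE] E_D by simp
    have diff: "J (q z) = J (q m) + (norm (z - t))\<^sup>2 + (m \<bullet> m - t \<bullet> t)"
      using Jz Jm zt2 by simp
    have "q z = q m" if "J (q z) \<le> J (q m)"
    proof -
      have zero: "(norm (z - t))\<^sup>2 = 0" "m \<bullet> m - t \<bullet> t = 0"
        using that diff tm zero_le_power2[of "norm (z - t)"] by linarith+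
      then have z_eq: "z = t" by simp
      have D0: "AE \<omega> in M. D (Y \<omega>) = 0"
        using integral_nonneg_eq_0_iff_AE[OF int_D D_AE] E_D zero by simp
      \<comment> \<open>One nonzero x with \<open>D x = 0\<close> suffices: equality then holds
        against almost every sample point, and each is aligned by the inverse of \<tau> x, which
        carries m to t. If Y vanishes almost surely there is no such x, but t = m = 0.\<close>
      have "\<exists>\<sigma>\<in>perms. t = act \<sigma> m"
      proof (cases "AE \<omega> in M. Y \<omega> = 0")
        case True
        then have "AE \<omega> in M. T (Y \<omega>) = 0" by eventually_elim (simp add: T_def)
        then have "t = 0" unfolding t_def by (subst integral_cong_AE[where g="\<lambda>_. 0"]) auto
        moreover have "m = 0" unfolding m_def using True by (subst integral_cong_AE[where g="\<lambda>_. 0"]) auto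
        ultimately show ?thesis by (intro bexI[of _ id]) auto
      next
        case False
        have "\<exists>\<omega>. D (Y \<omega>) = 0 \<and> Y \<omega> \<in> K' \<and> Y \<omega> \<noteq> 0"
        proof (rule ccontr)
          assume *: "\<not> ?thesis"
          have "AE \<omega> in M. Y \<omega> = 0" using D0 Y(2) by eventually_elim (use * in blast)
          then show False using False by blast
        qed
        then obtain x where x: "D x = 0" "x \<in> K'" "x \<noteq> 0" by blast
        have "AE \<omega> in M. x \<bullet> Y \<omega> - T x \<bullet> T (Y \<omega>) \<ge> 0"
          using Y(2) by eventually_elim (use T_inner_le x in auto)
        then have "AE \<omega> in M. x \<bullet> Y \<omega> - T x \<bullet> T (Y \<omega>) = 0"
          using x(1) int_Y int_T unfolding D_eq
          by (subst (asm) integral_nonneg_eq_0_iff_AE) auto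
        then have "AE \<omega> in M. T (Y \<omega>) = act (inv (\<tau> x)) (Y \<omega>)"
          using Y(2) by eventually_elim (use T_inner_eq x in auto)
        then have "t = (\<integral>\<omega>. act (inv (\<tau> x)) (Y \<omega>) \<partial>M)"
          unfolding t_def
          by (intro integral_cong_AE)
             (auto intro!: measurable_compose[OF Y(1)] borel_measurable_continuous_onI
                linear_continuous_on bounded_linear_act)
        also have "\<dots> = act (inv (\<tau> x)) m"
          unfolding m_def by (rule integral_bounded_linear[OF bounded_linear_act int_Y])
        finally show ?thesis using inv_in_perms[OF \<tau>(1)] by blast
      qed
      then show ?thesis using q_eq_iff[OF orth[OF m] z] z_eq by simp
    qed
    then show ?thesis using intz diff tm by (auto simp: add_nonneg_nonneg)
  qed
  obtain z where "z \<in> orthant" "p = q z" by (rule q_cases)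
  then show "integrable M (\<lambda>\<omega>. (dist p (q (Y \<omega>)))\<^sup>2)" "J (q m) \<le> J p" "J p \<le> J (q m) \<Longrightarrow> p = q m"
    using main by auto
qed

text \<open>The Frechet functional is finite at every p, so the extended-valued comparison is one of
  real integrals.\<close>

lemma (in prob_space) frechet_mean_distr_iff:
  fixes Y :: "'a \<Rightarrow> ('v::card2) weights"
  assumes w: "distinct_weights w"
    and K': "compact K'" "convex K'" "K' \<subseteq> cone_about w (min_angle w / 4)"
    and Y: "Y \<in> borel_measurable M" "AE \<omega> in M. Y \<omega> \<in> K'"
  shows "frechet_mean (distr M borel (\<lambda>\<omega>. q (Y \<omega>))) p \<longleftrightarrow> p = q (expectation Y)"
proof -
  let ?J = "\<lambda>p. \<integral>\<omega>. (dist p (q (Y \<omega>)))\<^sup>2 \<partial>M"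
  have "(\<integral>\<^sup>+z. ennreal ((dist p z)\<^sup>2) \<partial>distr M borel (\<lambda>\<omega>. q (Y \<omega>))) = ennreal (?J p)" for p
  proof -
    have [measurable]: "(\<lambda>y. dist p y) \<in> borel_measurable borel"
      by (intro borel_measurable_continuous_onI continuous_intros)
    have "(\<integral>\<^sup>+z. ennreal ((dist p z)\<^sup>2) \<partial>distr M borel (\<lambda>\<omega>. q (Y \<omega>)))
        = (\<integral>\<^sup>+\<omega>. ennreal ((dist p (q (Y \<omega>)))\<^sup>2) \<partial>M)"
      using Y(1) by (subst nn_integral_distr) auto
    also have "\<dots> = ennreal (?J p)"
      by (intro nn_integral_eq_integral frechet_functional_integrable[OF w K' Y]) auto
    finally show ?thesis .
  qed
  then have "frechet_mean (distr M borel (\<lambda>\<omega>. q (Y \<omega>))) p \<longleftrightarrow> (\<forall>p'. ?J p \<le> ?J p')"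
    unfolding frechet_mean_def by (simp add: ennreal_le_iff)
  also have "\<dots> \<longleftrightarrow> p = q (expectation Y)"
    using frechet_functional_le[OF w K' Y] frechet_functional_eq[OF w K' Y] by blast
  finally show ?thesis .
qed

text \<open>The result for distributions, applied to the uniform law on the indices; coinciding
  sample points thus keep their multiplicity.\<close>

lemma empirical_frechet_mean_unique:
  fixes y :: "nat \<Rightarrow> ('v::card2) weights"
  assumes w: "distinct_weights w"
    and K': "compact K'" "convex K'" "K' \<subseteq> cone_about w (min_angle w / 4)"
    and n: "n \<ge> 1" and y: "\<And>i. i < n \<Longrightarrow> y i \<in> K'"
    and p: "empirical_frechet_mean n (\<lambda>i. q (y i)) p"
  shows "p = q ((1 / real n) *\<^sub>R (\<Sum>i<n. y i))" "(1 / real n) *\<^sub>R (\<Sum>i<n. y i) \<in> K'"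
proof -
  let ?P = "measure_pmf (pmf_of_set {..<n})"
  have ne: "{..<n} \<noteq> {}" "finite {..<n}" using n by (auto simp: lessThan_empty_iff)
  have Y: "y \<in> borel_measurable ?P" "AE i in ?P. y i \<in> K'"
    using ne y by (auto simp: AE_measure_pmf_iff)
  have mean: "integral\<^sup>L ?P y = (1 / real n) *\<^sub>R (\<Sum>i<n. y i)"
    using ne by (subst integral_measure_pmf[of "{..<n}"]) (auto simp: scaleR_sum_right)
  have J: "(\<integral>i. (dist p (q (y i)))\<^sup>2 \<partial>?P) = 1 / real n * (\<Sum>i<n. (dist p (q (y i)))\<^sup>2)" for p
    using ne by (subst integral_pmf_of_set) auto
  show "(1 / real n) *\<^sub>R (\<Sum>i<n. y i) \<in> K'"
    using measure_pmf.frechet_functional_mean[OF w K' Y] mean by simp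
  have "(\<integral>i. (dist p (q (y i)))\<^sup>2 \<partial>?P) \<le> (\<integral>i. (dist (q (integral\<^sup>L ?P y)) (q (y i)))\<^sup>2 \<partial>?P)"
    using p unfolding J empirical_frechet_mean_def by blast
  then show "p = q ((1 / real n) *\<^sub>R (\<Sum>i<n. y i))"
    using measure_pmf.frechet_functional_eq[OF w K' Y, of p] mean by simp
qed


section \<open>Limit law of the empirical Frechet mean\<close>

lemma partial_deriv_norm_squared:
  "partial_deriv r (\<lambda>x. (norm (x - y))\<^sup>2) x = 2 * (x $ r - y $ r)"
proof -
  have "(norm (x + t *\<^sub>R axis r 1 - y))\<^sup>2 = (norm (x - y))\<^sup>2 + 2 * t * (x $ r - y $ r) + t\<^sup>2" for t
    unfolding power2_norm_eq_inner
    by (simp add: inner_diff_left inner_diff_right inner_add_left inner_add_right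
        inner_axis inner_axis' inner_commute algebra_simps power2_eq_square)
  moreover have "((\<lambda>t. (norm (x - y))\<^sup>2 + 2 * t * (x $ r - y $ r) + t\<^sup>2)
      has_real_derivative 2 * (x $ r - y $ r)) (at 0)"
    by (auto intro!: derivative_eq_intros)
  ultimately show ?thesis
    unfolding partial_deriv_def by (simp add: DERIV_imp_deriv)
qed

lemma partial_deriv_coordinate:
  "partial_deriv r (\<lambda>x. 2 * (x $ s - c)) x = (if r = s then 2 else 0)"
proof -
  have "((\<lambda>t. 2 * ((x + t *\<^sub>R axis r 1) $ s - c)) has_real_derivative (if r = s then 2 else 0)) (at 0)"
    by (auto intro!: derivative_eq_intros simp: axis_def)
  then show ?thesis unfolding partial_deriv_def by (rule DERIV_imp_deriv)
qed

lemma mat_mult_component: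
  fixes A :: "real ^ 'n ^ 'n"
  shows "(mat c ** A) $ r $ s = c * A $ r $ s" "(A ** mat c) $ r $ s = c * A $ r $ s"
  by (simp_all add: matrix_matrix_mult_def mat_def if_distrib if_distribR sum.delta sum.delta' cong: if_cong)

text \<open>\<open>matrix_inv\<close> is defined by choice, so uniqueness of the inverse is needed
  to evaluate it.\<close>

lemma matrix_inv_mat:
  assumes "c \<noteq> 0"
  shows "matrix_inv (mat c :: real ^ 'n ^ 'n) = mat (inverse c)"
proof -
  have eq: "mat c ** mat (inverse c) = (mat 1 :: real ^ 'n ^ 'n)"
    "mat (inverse c) ** mat c = (mat 1 :: real ^ 'n ^ 'n)"
    using assms by (auto simp: vec_eq_iff mat_mult_component) (auto simp: mat_def)
  have uniq: "B = mat (inverse c)" if "mat c ** B = mat 1" for B :: "real ^ 'n ^ 'n"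
    by (metis eq(2) matrix_mul_assoc matrix_mul_lid matrix_mul_rid that)
  show ?thesis
    unfolding matrix_inv_def by (rule some_equality) (use eq uniq in blast)+
qed

lemma quadratic_form_expectation:
  fixes U :: "'a \<Rightarrow> real ^ 'n"
  assumes "\<And>r s. integrable M (\<lambda>\<omega>. U \<omega> $ r * U \<omega> $ s)"
  shows "t \<bullet> ((\<chi> r s. \<integral>\<omega>. U \<omega> $ r * U \<omega> $ s \<partial>M) *v t) = (\<integral>\<omega>. (t \<bullet> U \<omega>)\<^sup>2 \<partial>M)"
proof -
  have "(t \<bullet> U \<omega>)\<^sup>2 = (\<Sum>r\<in>UNIV. \<Sum>s\<in>UNIV. t $ r * t $ s * (U \<omega> $ r * U \<omega> $ s))" for \<omega>
    by (simp add: inner_vec_def power2_eq_square sum_product mult_ac)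
  then have "(\<integral>\<omega>. (t \<bullet> U \<omega>)\<^sup>2 \<partial>M)
      = (\<Sum>r\<in>UNIV. \<Sum>s\<in>UNIV. t $ r * t $ s * (\<integral>\<omega>. U \<omega> $ r * U \<omega> $ s \<partial>M))"
    using assms by (simp add: Bochner_Integration.integral_sum)
  then show ?thesis
    by (simp add: inner_vec_def matrix_vector_mult_def sum_distrib_left mult_ac)
qed

text \<open>Off the image, \<open>the_inv_into\<close> takes the single default value
  \<open>THE x. False\<close>; it is thus continuous on a closed set and constant elsewhere.\<close>

lemma homeomorphism_inverse_measurable:
  fixes q :: "'a::metric_space \<Rightarrow> 'b::metric_space"
  assumes "homeomorphism S T q (the_inv_into S q)" "compact S"
  shows "the_inv_into S q \<in> borel_measurable borel"
proof -
  have T: "q ` S = T" "continuous_on S q" "continuous_on T (the_inv_into S q)"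
    using assms(1) by (auto simp: homeomorphism_def)
  have "closed T" using compact_continuous_image[OF T(2) assms(2)] T(1) compact_imp_closed by blast
  moreover have "the_inv_into S q = (\<lambda>p. if p \<in> T then the_inv_into S q p else (THE x. False))"
    using T(1) by (fastforce simp: the_inv_into_def fun_eq_iff intro!: arg_cong[where f=The])
  ultimately show ?thesis
    using T(3) borel_measurable_continuous_on_if[of T "the_inv_into S q" "\<lambda>_. THE x. False"]
    by (simp add: borel_closed continuous_on_const)
qed

theorem theorem3p4:
  fixes w :: "('v::card2) weights"
    and K' :: "'v weights set"
    and K :: "'v unlabeled_network set"
    and \<phi> :: "'v unlabeled_network \<Rightarrow> 'v weights"
    and Q' :: "'v weights measure"
    and Q :: "'v unlabeled_network measure"
    and \<mu> :: "'v unlabeled_network"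
    and M :: "'w measure"
    and X :: "nat \<Rightarrow> 'w \<Rightarrow> 'v unlabeled_network"
    and \<mu>n :: "nat \<Rightarrow> 'w \<Rightarrow> 'v unlabeled_network"
    and \<Lambda> C \<Sigma> :: "real ^ ('v edge) ^ ('v edge)"
  assumes w: "distinct_weights w"
    and K': "compact K'" "convex K'" "K' \<subseteq> cone_about w (min_angle w / 4)"
    and \<phi>: "\<phi> = the_inv_into K' q" "homeomorphism K' K q \<phi>"
    and Q': "prob_space Q'" "sets Q' = sets borel" "measure Q' K' = 1"
    and Q: "Q = distr Q' borel q"
    and \<mu>: "\<mu> = (THE p. frechet_mean Q p)"
    and M: "prob_space M"
    and iid: "prob_space.indep_vars M (\<lambda>_. borel) X UNIV" "\<And>i. distr M borel (X i) = Q"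
    and \<mu>n_measurable: "\<And>n. n \<ge> 1 \<Longrightarrow> \<mu>n n \<in> borel_measurable M"
    and \<mu>n: "\<And>n. n \<ge> 1 \<Longrightarrow> AE \<omega> in M. empirical_frechet_mean n (\<lambda>i. X i \<omega>) (\<mu>n n \<omega>)"
    and \<Lambda>: "\<Lambda> = (\<chi> r s. \<integral>\<omega>. partial_deriv r (partial_deriv s (\<lambda>x. (norm (x - \<phi> (X 0 \<omega>)))\<^sup>2)) (\<phi> \<mu>) \<partial>M)"
    and C: "C = covariance_matrix M (\<lambda>\<omega>. \<chi> r. partial_deriv r (\<lambda>x. (norm (x - \<phi> (X 0 \<omega>)))\<^sup>2) (\<phi> \<mu>))"
    and \<Sigma>: "\<Sigma> = matrix_inv \<Lambda> ** C ** matrix_inv \<Lambda>"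
  shows "(\<exists>!p. frechet_mean Q p) \<and>
    (\<exists>N. normal_law N 0 \<Sigma> \<and>
      converges_in_law M (\<lambda>n \<omega>. sqrt (real n) *\<^sub>R (\<phi> (\<mu>n n \<omega>) - \<phi> \<mu>)) N)"
proof -
  interpret M: prob_space M by (rule M)
  interpret Q': prob_space Q' by (rule Q'(1))
  have closed: "closed K'" by (rule compact_imp_closed[OF K'(1)])
  have hom: "\<And>x. x \<in> K' \<Longrightarrow> \<phi> (q x) = x" "q ` K' = K" "\<phi> ` K = K'" "\<And>p. p \<in> K \<Longrightarrow> q (\<phi> p) = p"
    using \<phi>(2) by (auto simp: homeomorphism_def)
  have Kclosed: "closed K"
    using compact_continuous_image[of K' q] \<phi>(2) K'(1) compact_imp_closed
    by (auto simp: homeomorphism_def)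
  have [measurable]: "\<phi> \<in> borel_measurable borel"
    using homeomorphism_inverse_measurable[of K' K q] \<phi> K'(1) by simp
  have id: "(\<lambda>x. x) \<in> borel_measurable Q'"
    using Q'(2) by (simp add: measurable_def sets_eq_imp_space_eq)
  have q_meas: "q \<in> measurable Q' borel"
    using measurable_q Q'(2) by (simp cong: measurable_cong_sets)
  have AE_Q': "AE x in Q'. x \<in> K'"
    using Q'.prob_eq_1[of K'] Q' closed by (simp add: borel_closed)

  \<comment> \<open>The population mean\<close>
  define m where "m = (\<integral>x. x \<partial>Q')"
  have m: "m \<in> K'"
    using Q'.frechet_functional_mean[OF w K' id AE_Q'] by (simp add: m_def)
  have mean_iff: "frechet_mean Q p \<longleftrightarrow> p = q m" for p
    using Q'.frechet_mean_distr_iff[OF w K' id AE_Q'] by (simp add: Q m_def)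
  then have \<mu>_eq: "\<mu> = q m" and unique: "\<exists>!p. frechet_mean Q p" by (simp_all add: \<mu>)
  have \<phi>\<mu>: "\<phi> \<mu> = m" by (simp add: \<mu>_eq hom m)

  \<comment> \<open>The sample lifted to K'\<close>
  have X [measurable]: "X i \<in> borel_measurable M" for i
    using iid(1) by (simp add: M.indep_vars_def2)
  define Y where "Y i \<omega> = \<phi> (X i \<omega>)" for i \<omega>
  have Y [measurable]: "Y i \<in> borel_measurable M" for i unfolding Y_def by measurable
  have AE_X: "AE \<omega> in M. X i \<omega> \<in> K" for i
  proof -
    have "AE p in Q. p \<in> K"
      unfolding Q using AE_Q' hom(2) Kclosed
      by (subst AE_distr_iff[OF q_meas]) (auto simp: borel_closed)
    then show ?thesis
      unfolding iid(2)[of i, symmetric] using Kclosed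
      by (subst (asm) AE_distr_iff) (auto simp: borel_closed)
  qed
  have AE_Y: "AE \<omega> in M. Y i \<omega> \<in> K' \<and> X i \<omega> = q (Y i \<omega>)" for i
    using AE_X[of i] by eventually_elim (auto simp: Y_def hom(3)[symmetric] hom(4))
  have Y_indep: "M.indep_vars (\<lambda>_. borel) Y UNIV"
    unfolding Y_def by (rule M.indep_vars_compose2[OF iid(1)]) simp
  have Y_distr: "distr M borel (Y i) = distr Q borel \<phi>" for i
    unfolding iid(2)[of i, symmetric] Y_def by (subst distr_distr) (auto simp: comp_def)
  obtain B where B: "\<And>x. x \<in> K' \<Longrightarrow> norm x \<le> B"
    using compact_imp_bounded[OF K'(1)] by (auto simp: bounded_iff)
  have Y_bound: "AE \<omega> in M. norm (Y 0 \<omega>) \<le> B"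
    using AE_Y[of 0] by eventually_elim (simp add: B)
  have Y_int: "integrable M (Y 0)"
    by (rule M.integrable_const_bound[OF Y_bound Y])
  have Y_sq: "integrable M (\<lambda>\<omega>. (norm (Y 0 \<omega>))\<^sup>2)"
    by (rule M.integrable_const_bound[of _ "B\<^sup>2"]) (use Y_bound in \<open>auto intro!: power_mono\<close>)
  have Y_mean: "M.expectation (Y 0) = m"
  proof -
    have "M.expectation (Y 0) = (\<integral>x. x \<partial>distr M borel (Y 0))" by (subst integral_distr) auto
    also have "\<dots> = (\<integral>x. \<phi> (q x) \<partial>Q')"
      unfolding Y_distr Q using q_meas by (simp add: integral_distr)
    also have "\<dots> = m"
      unfolding m_def
      by (rule integral_cong_AE)
         (use AE_Q' hom id measurable_compose[OF q_meas, of \<phi> borel] in auto)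
    finally show ?thesis .
  qed

  \<comment> \<open>The limiting covariance\<close>
  define U where "U \<omega> = Y 0 \<omega> - m" for \<omega>
  have U [measurable]: "U \<in> borel_measurable M" unfolding U_def by measurable
  have AE_U: "AE \<omega> in M. U \<omega> \<in> (\<lambda>x. x - m) ` K'"
    using AE_Y[of 0] by eventually_elim (simp add: U_def)
  have U_int: "integrable M U" unfolding U_def using Y_int by simp
  have U_mean: "(\<integral>\<omega>. U \<omega> $ r \<partial>M) = 0" for r
  proof -
    have "(\<integral>\<omega>. U \<omega> $ r \<partial>M) = M.expectation U $ r"
      by (rule integral_bounded_linear[OF bounded_linear_vec_nth U_int])
    also have "M.expectation U = 0" unfolding U_def using Y_int Y_mean by (simp add: M.prob_space)
    finally show ?thesis by simp
  qed
  have compact_U: "compact ((\<lambda>x. x - m) ` K')"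
    using K'(1) by (intro compact_continuous_image continuous_intros)
  have U_comp [measurable]: "(\<lambda>\<omega>. U \<omega> $ r) \<in> borel_measurable M" for r
    by (rule measurable_compose[OF U]) (intro borel_measurable_continuous_onI continuous_intros)
  have U_prod: "integrable M (\<lambda>\<omega>. U \<omega> $ r * U \<omega> $ s)" for r s
  proof -
    have "AE \<omega> in M. norm (U \<omega> $ r * U \<omega> $ s) \<le> (B + norm m) * (B + norm m)"
      using Y_bound
    proof eventually_elim
      case (elim \<omega>)
      have "norm (U \<omega>) \<le> B + norm m"
        unfolding U_def using norm_triangle_ineq4[of "Y 0 \<omega>" m] elim by linarith
      then have "\<bar>U \<omega> $ k\<bar> \<le> B + norm m" for k using component_le_norm_cart[of "U \<omega>" k] by linarith
      then show ?case by (auto simp: abs_mult intro!: mult_mono intro: order_trans[OF abs_ge_zero])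
    qed
    then show ?thesis by (rule M.integrable_const_bound) measurable
  qed

  \<comment> \<open>The gradient is -2U, so C is 4 times the covariance of \<open>Y 0\<close>; the
    two factors 1/2 from the inverse Hessian cancel the 4.\<close>
  have "\<Lambda> = mat 2"
    unfolding \<Lambda> partial_deriv_norm_squared partial_deriv_coordinate
    by (simp add: vec_eq_iff mat_def M.prob_space)
  then have inv: "matrix_inv \<Lambda> = mat (1 / 2)" by (simp add: matrix_inv_mat)
  have grad: "(\<chi> r. partial_deriv r (\<lambda>x. (norm (x - \<phi> (X 0 \<omega>)))\<^sup>2) (\<phi> \<mu>)) = (- 2) *\<^sub>R U \<omega>" for \<omega>
    by (simp add: partial_deriv_norm_squared vec_eq_iff U_def Y_def \<phi>\<mu>)
  have C_eq: "C $ r $ s = 4 * (\<integral>\<omega>. U \<omega> $ r * U \<omega> $ s \<partial>M)" for r s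
    unfolding C grad covariance_matrix_def by (simp add: U_mean)
  have \<Sigma>_eq: "\<Sigma> = (\<chi> r s. \<integral>\<omega>. U \<omega> $ r * U \<omega> $ s \<partial>M)"
    unfolding \<Sigma> inv by (simp add: vec_eq_iff mat_mult_component C_eq)
  have quad: "t \<bullet> (\<Sigma> *v t) = (\<integral>\<omega>. (t \<bullet> U \<omega>)\<^sup>2 \<partial>M)" for t
    unfolding \<Sigma>_eq by (rule quadratic_form_expectation[OF U_prod])

  \<comment> \<open>The Gaussian limit and convergence in law\<close>
  obtain T u where T: "finite T" "\<And>s. s \<in> T \<Longrightarrow> 0 \<le> u s"
    "\<And>t. (\<integral>\<omega>. (t \<bullet> U \<omega>)\<^sup>2 \<partial>M) = (\<Sum>s\<in>T. u s * (t \<bullet> s)\<^sup>2)"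
    using M.second_moment_finite_sum[OF U AE_U compact_U] by blast
  obtain N :: "'v weights measure" where N: "prob_space N" "sets N = sets borel"
    "\<And>t. (CLINT x|N. iexp (t \<bullet> x)) = exp (- of_real (\<integral>\<omega>. (t \<bullet> U \<omega>)\<^sup>2 \<partial>M) / 2)"
    using gaussian_exists[where u=u, OF T(1) T(2)] unfolding T(3) by blast
  have "normal_law N 0 \<Sigma>"
    unfolding normal_law_def using N
    by (auto simp: quad \<Sigma>_eq[unfolded vec_eq_iff] transpose_def vec_eq_iff mult.commute)
  moreover have "converges_in_law M (\<lambda>n \<omega>. sqrt (real n) *\<^sub>R (\<phi> (\<mu>n n \<omega>) - \<phi> \<mu>)) N"
    unfolding converges_in_law_def
  proof (intro conjI allI impI)
    show Z: "(\<lambda>\<omega>. sqrt (real n) *\<^sub>R (\<phi> (\<mu>n n \<omega>) - \<phi> \<mu>)) \<in> borel_measurable M" for n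
    \<comment> \<open>The value \<open>\<mu>n 0\<close> is unconstrained; the factor sqrt 0 turns
      the variable into the constant 0.\<close>
    proof (cases "n = 0")
      case False
      then have [measurable]: "\<mu>n n \<in> borel_measurable M" by (intro \<mu>n_measurable) simp
      show ?thesis by measurable
    qed simp
    fix f :: "'v weights \<Rightarrow> real"
    assume f: "continuous_on UNIV f \<and> bounded (range f)"
    have fm: "f \<in> borel_measurable borel" using f by (intro borel_measurable_continuous_onI) simp
    have AE_Z: "AE \<omega> in M. sqrt (real n) *\<^sub>R (\<phi> (\<mu>n n \<omega>) - \<phi> \<mu>)
        = (1 / sqrt (real n)) *\<^sub>R (\<Sum>i<n. Y i \<omega> - m)" for n
    proof (cases "n = 0")
      case False
      then have n: "n \<ge> 1" by simp
      have "AE \<omega> in M. \<forall>i. Y i \<omega> \<in> K' \<and> X i \<omega> = q (Y i \<omega>)"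
        using AE_Y by (simp add: AE_all_countable)
      with \<mu>n[OF n] show ?thesis
      proof eventually_elim
        case (elim \<omega>)
        then have mean: "empirical_frechet_mean n (\<lambda>i. q (Y i \<omega>)) (\<mu>n n \<omega>)" by simp
        have YK: "\<And>i. i < n \<Longrightarrow> Y i \<omega> \<in> K'" using elim by blast
        \<comment> \<open>By convexity the sample average lies in K', where \<phi> undoes q.\<close>
        have "\<phi> (\<mu>n n \<omega>) = (1 / real n) *\<^sub>R (\<Sum>i<n. Y i \<omega>)"
          using empirical_frechet_mean_unique[OF w K' n YK mean] hom(1) by simp
        moreover have "sqrt (real n) / real n = 1 / sqrt (real n)"
          using False by (simp add: real_sqrt_divide field_simps)
        moreover have "real n / sqrt (real n) = sqrt (real n)" by (rule real_div_sqrt) simp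
        ultimately show ?case
          by (simp add: \<phi>\<mu> scaleR_diff_right sum_subtractf sum_constant_scaleR del: sum_constant)
      qed
    qed simp
    have "(\<integral>\<omega>. f (sqrt (real n) *\<^sub>R (\<phi> (\<mu>n n \<omega>) - \<phi> \<mu>)) \<partial>M)
        = (\<integral>\<omega>. f ((1 / sqrt (real n)) *\<^sub>R (\<Sum>i<n. Y i \<omega> - m)) \<partial>M)" for n
      by (rule integral_cong_AE)
         (use AE_Z[of n] measurable_compose[OF Z fm] fm in auto)
    moreover have "(\<lambda>n. \<integral>\<omega>. f ((1 / sqrt (real n)) *\<^sub>R (\<Sum>i<n. Y i \<omega> - m)) \<partial>M) \<longlonglongrightarrow> (\<integral>x. f x \<partial>N)"
      using f N(3)[unfolded U_def]
      by (intro M.multivariate_central_limit_theorem[OF Y_indep Y_distr Y_sq Y_mean[symmetric] N(1,2)]) auto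
    ultimately show "(\<lambda>n. \<integral>\<omega>. f (sqrt (real n) *\<^sub>R (\<phi> (\<mu>n n \<omega>) - \<phi> \<mu>)) \<partial>M) \<longlonglongrightarrow> (\<integral>x. f x \<partial>N)"
      by simp
  qed
  ultimately show ?thesis using unique by blast
qed

end
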